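(* Let $n \geq 2$ be an integer, let $p > n$ and $1 \leq q < p$. Put $X(t) = (1 - \log t)^{-1}$ for $t \in (0,1]$. There exist constants $\Theta = \Theta(n,p,q) \geq 0$ and $C = C(n,p,q) > 0$, depending only on $n,p,q$, such that for every bounded domain $\Omega \subset \mathbb{R}^n$ containing the origin, all $u \in C_c^\infty(\Omega \setminus \{0\})$, any open ball $B_r \subset \mathbb{R}^n$ of radius $r \in (0, \operatorname{diam}(\Omega))$ (with arbitrary center), and any $D \geq e^{\Theta} \operatorname{diam}(\Omega)$, $$r^{n/p}\, X^{1/p}(r/D) \left( \frac{1}{|B_r|} \int_{B_r} \frac{|u|^q}{|x|^q}\, dx \right)^{1/q} \leq C \left[ \int_\Omega |\nabla u|^p\, dx - \left(\frac{p-n}{p}\right)^p \int_\Omega \frac{|u|^p}{|x|^p}\, dx \right]^{1/p}.$$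
   Context: A domain is an open connected subset of $\mathbb{R}^n$; $\operatorname{diam}(\Omega)$ is its diameter; $|B_r|$ is the Lebesgue measure of $B_r$. Functions in $C_c^\infty(\Omega\setminus\{0\})$ are extended by zero outside their support, so they are defined on all of $\mathbb{R}^n$. $X^{a}(t)$ means $(X(t))^a$. *)

theory Defs
  imports "HOL-Analysis.Analysis"
begin

text \<open>
  On an open set \<open>S\<close>, \<open>C_k k S f\<close> says that all iterated directional derivatives of \<open>f\<close> of
  order at most \<open>k\<close> exist and are continuous on \<open>S\<close>. The derivatives are taken in the whole
  space, so the predicate is meaningful for open \<open>S\<close> only.
\<close>

primrec C_k :: "nat \<Rightarrow> 'a::real_normed_vector set \<Rightarrow> ('a \<Rightarrow> 'b::real_normed_vector) \<Rightarrow> bool" where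
  "C_k 0 S f \<longleftrightarrow> continuous_on S f"
| "C_k (Suc k) S f \<longleftrightarrow>
     (\<forall>x\<in>S. f differentiable (at x)) \<and> (\<forall>v. C_k k S (\<lambda>x. frechet_derivative f (at x) v))"

definition smooth_on :: "'a::real_normed_vector set \<Rightarrow> ('a \<Rightarrow> 'b::real_normed_vector) \<Rightarrow> bool" where
  "smooth_on S f \<longleftrightarrow> (\<forall>k. C_k k S f)"

definition support :: "('a::topological_space \<Rightarrow> 'b::zero) \<Rightarrow> 'a set" where
  "support f = closure {x. f x \<noteq> 0}"

text \<open>
  Elements of \<open>test_functions U\<close> are total functions, already extended by zero outside \<open>U\<close>:
  the support, closed in the whole space, is a compact subset of \<open>U\<close>.
\<close>

definition test_functions :: "'a::real_normed_vector set \<Rightarrow> ('a \<Rightarrow> real) set" where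
  "test_functions U = {u. smooth_on U u \<and> compact (support u) \<and> support u \<subseteq> U}"

definition gradient :: "(real ^ 'n \<Rightarrow> real) \<Rightarrow> real ^ 'n \<Rightarrow> real ^ 'n" where
  "gradient u x = (\<chi> i. frechet_derivative u (at x) (axis i 1))"

text \<open>Only used for \<open>0 < t \<le> 1\<close>.\<close>

definition X :: "real \<Rightarrow> real" where
  "X t = inverse (1 - ln t)"

text \<open>
  The quotient by \<open>norm x powr p\<close> is \<open>0\<close> at the origin by the convention \<open>x / 0 = 0\<close>; this is
  harmless, the origin being a null set. For real \<open>x\<close>, \<open>(- x) powr a = x powr a\<close>, so a bound by
  \<open>hardy_difference p \<Omega> u powr (1 / p)\<close> carries its usual meaning only together with
  \<open>hardy_difference p \<Omega> u \<ge> 0\<close>.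
\<close>

definition hardy_difference :: "real \<Rightarrow> (real ^ 'n) set \<Rightarrow> (real ^ 'n \<Rightarrow> real) \<Rightarrow> real" where
  "hardy_difference p \<Omega> u =
     (LINT x:\<Omega>|lebesgue. norm (gradient u x) powr p)
     - ((p - real CARD('n)) / p) powr p * (LINT x:\<Omega>|lebesgue. \<bar>u x\<bar> powr p / norm x powr p)"

end

theory Submission
  imports Defs
begin

text \<open>
  Let \<open>n\<close> be the dimension, \<open>H = (p - n) / p\<close>,
  \<open>s = 1 / X (r / D) = 1 + ln (D / r)\<close> and \<open>R = norm z + r\<close>, so that
  \<open>ball z r\<close> lies in the ball of radius \<open>R\<close> about the origin. The theorem follows
  from a Hardy inequality with a remainder that is adapted to the given ball: the Hardy difference dominates
  the integral of \<open>\<bar>u\<bar> powr p / norm x powr p\<close> against a nonnegative weight which on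
  \<open>ball z r\<close> is at least a constant times \<open>(norm x / R) powr (2 * \<beta>) / s\<close>,
  where \<open>\<beta> > 0\<close> can be as small as desired.

  Given this, Hoelder's inequality with exponents \<open>p / q\<close> and \<open>p / (p - q)\<close> bounds
  the integral of \<open>\<bar>u\<bar> powr q / norm x powr q\<close> over the ball by the Hardy difference
  to the power \<open>q / p\<close> and a power of the integral of
  \<open>s powr \<kappa> * (norm x / R) powr (- 2 * \<beta> * \<kappa>)\<close> with
  \<open>\<kappa> = q / (p - q)\<close>. For small \<open>\<beta>\<close> the exponent is larger than
  \<open>- n\<close> and this integral is at most a constant times \<open>s powr \<kappa> * r ^ n\<close>,
  uniformly in the centre (\<open>integral_norm_powr_ball\<close>). Taking roots gives exactly the powers of
  \<open>r\<close> and of \<open>X (r / D)\<close> in the theorem.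

  The weighted Hardy inequality comes from a vector field. For a radial field
  \<open>\<eta> (norm x) *\<^sub>R x\<close>, the divergence theorem for \<open>\<bar>u\<bar> powr p\<close>
  times the field together with Young's inequality yields a lower bound for the integral of the
  \<open>p\<close>-th power of the gradient (\<open>Hardy_inequality_radial_field\<close>). The classical
  field, a multiple of \<open>norm x powr (- p) *\<^sub>R x\<close>, produces the sharp Hardy constant. It
  is multiplied by \<open>1 - 1 / g\<close>, where \<open>g = H * (1 + ln (D / norm x)) + 1\<close> alone
  would solve the Riccati equation that makes the first-order gain equal to the second-order loss. A further
  summand of \<open>g\<close> that rises by \<open>s\<close> as \<open>norm x\<close> passes below the scale
  \<open>R\<close> then makes the gain exceed the loss around that scale by a weight of order
  \<open>1 / s\<close> (\<open>improved_Hardy_inequality\<close>,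
  \<open>logarithmic_weight_lower_bound\<close>). The argument works for every \<open>D\<close> that is at
  least the diameter, hence with \<open>\<Theta> = 0\<close>.
\<close>

section \<open>Integration by parts for functions of compact support\<close>

lemma continuous_on_extend_by_zero:
  fixes f :: "'a::topological_space \<Rightarrow> 'b::real_normed_vector"
  assumes "open U" "closed K" "K \<subseteq> U" "continuous_on U f" "\<And>x. x \<notin> K \<Longrightarrow> f x = 0"
  shows "continuous_on UNIV f"
proof -
  have "continuous_on (- K) f"
    using assms(5) by (intro continuous_on_eq[OF continuous_on_const[of _ 0]]) auto
  then have "continuous_on (U \<union> - K) f"
    using assms by (intro continuous_on_open_Un) auto
  moreover have "U \<union> - K = UNIV" using \<open>K \<subseteq> U\<close> by auto
  ultimately show ?thesis by simp
qed

lemma integrable_compact_support: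
  fixes f :: "'a::euclidean_space \<Rightarrow> real"
  assumes "compact K" "continuous_on UNIV f" "\<And>x. x \<notin> K \<Longrightarrow> f x = 0"
  shows "integrable lborel f"
proof -
  have "integrable lborel (\<lambda>x. indicator K x *\<^sub>R f x)"
    using assms by (intro borel_integrable_compact continuous_on_subset[OF assms(2)]) auto
  moreover have "(\<lambda>x. indicator K x *\<^sub>R f x) = f"
    using assms(3) by (auto simp: fun_eq_iff indicator_def)
  ultimately show ?thesis by simp
qed

lemma compact_support_bounded:
  fixes f :: "'a::topological_space \<Rightarrow> real"
  assumes "compact K" "continuous_on UNIV f" "\<And>x. x \<notin> K \<Longrightarrow> f x = 0"
  obtains B where "\<And>x. \<bar>f x\<bar> \<le> B" "B \<ge> 0"
proof -
  have "bounded (f ` K)"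
    using assms by (intro compact_imp_bounded compact_continuous_image continuous_on_subset[OF assms(2)]) auto
  then obtain B where "\<And>x. x \<in> K \<Longrightarrow> \<bar>f x\<bar> \<le> B" unfolding bounded_iff by auto
  then have "\<bar>f x\<bar> \<le> max B 0" for x using assms(3)[of x] by (cases "x \<in> K") fastforce+
  then show ?thesis using that[of "max B 0"] by auto
qed

lemma derivative_zero_off_support:
  fixes F :: "'a::euclidean_space \<Rightarrow> real"
  assumes K: "compact K" "\<And>x. x \<notin> K \<Longrightarrow> F x = 0"
    and der: "(F has_derivative F') (at x)" and "x \<notin> K"
  shows "F' = (\<lambda>_. 0)"
proof -
  have "open (- K)" using K(1) by (simp add: compact_imp_closed open_Compl)
  then have "(F has_derivative (\<lambda>_. 0)) (at x)"
    using \<open>x \<notin> K\<close> K(2)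
    by (intro has_derivative_transform_within_open[of "\<lambda>_. 0" _ x UNIV "- K" F]) auto
  then show ?thesis using der by (metis has_derivative_unique)
qed

lemma integral_translate:
  fixes f :: "'a::euclidean_space \<Rightarrow> real"
  assumes "f \<in> borel_measurable borel"
  shows "(\<integral>x. f (x + a) \<partial>lborel) = (\<integral>x. f x \<partial>lborel)"
proof -
  have "(\<integral>x. f x \<partial>lborel) = (\<integral>x. f x \<partial>distr lborel borel ((+) a))"
    by (simp add: lborel_distr_plus)
  also have "\<dots> = (\<integral>x. f (a + x) \<partial>lborel)"
    using assms by (intro integral_distr) auto
  finally show ?thesis by (simp add: add.commute)
qed

text \<open>
  The integral of a difference quotient vanishes by translation invariance of Lebesgue measure, and the
  difference quotients converge boundedly, on a fixed ball, to the directional derivative. This replaces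
  Fubini and the fundamental theorem of calculus in integration by parts.
\<close>

lemma integral_directional_derivative_zero:
  fixes F :: "'a::euclidean_space \<Rightarrow> real"
  assumes der: "\<And>x. (F has_derivative F' x) (at x)"
    and cont: "continuous_on UNIV (\<lambda>x. F' x v)"
    and K: "compact K" "\<And>x. x \<notin> K \<Longrightarrow> F x = 0"
  shows "(\<integral>x. F' x v \<partial>lborel) = 0"
proof -
  have contF: "continuous_on UNIV F"
    using der by (intro continuous_at_imp_continuous_on ballI has_derivative_continuous) blast
  have [measurable]: "F \<in> borel_measurable borel"
    using contF by (rule borel_measurable_continuous_onI)
  have lin: "linear (F' x)" for x using der by (rule has_derivative_linear)
  have line: "((\<lambda>\<xi>. F (x + \<xi> *\<^sub>R v)) has_real_derivative F' (x + t *\<^sub>R v) v) (at t)" for x t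
  proof -
    have "((\<lambda>\<xi>. F (x + \<xi> *\<^sub>R v)) has_derivative (\<lambda>h. F' (x + t *\<^sub>R v) (h *\<^sub>R v))) (at t)"
      by (rule has_derivative_compose[OF _ der]) (auto intro!: derivative_eq_intros)
    then show ?thesis
      using lin by (simp add: has_field_derivative_def linear_cmul mult.commute[of _ "F' _ _"])
  qed
  have K': "F' x v = 0" if "x \<notin> K" for x
    using derivative_zero_off_support[OF K der] that by simp
  obtain B where B: "\<And>x. \<bar>F' x v\<bar> \<le> B" "B \<ge> 0"
    using compact_support_bounded[OF K(1) cont K'] by blast
  obtain b where b: "\<And>x. x \<in> K \<Longrightarrow> norm x \<le> b"
    using compact_imp_bounded[OF K(1)] unfolding bounded_iff by auto
  define t where "t k = inverse (real (Suc k))" for k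
  have t: "0 < t k" "t k \<le> 1" for k by (auto simp: t_def field_simps)
  have tlim: "t \<longlonglongrightarrow> 0" unfolding t_def by (rule LIMSEQ_inverse_real_of_nat)
  define Q where "Q k x = (F (x + t k *\<^sub>R v) - F x) / t k" for k x
  have [measurable]: "Q k \<in> borel_measurable borel" for k
    unfolding Q_def by measurable
  have Q0: "(\<integral>x. Q k x \<partial>lborel) = 0" for k
  proof -
    have i: "integrable lborel F" by (rule integrable_compact_support[OF K(1) contF K(2)])
    have j: "integrable lborel (\<lambda>x. F (x + t k *\<^sub>R v))"
    proof (rule integrable_compact_support[where K = "(\<lambda>x. x - t k *\<^sub>R v) ` K"])
      show "compact ((\<lambda>x. x - t k *\<^sub>R v) ` K)"
        by (intro compact_continuous_image continuous_intros K)
      show "continuous_on UNIV (\<lambda>x. F (x + t k *\<^sub>R v))"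
        by (intro continuous_on_compose2[OF contF] continuous_intros) auto
      show "F (x + t k *\<^sub>R v) = 0" if "x \<notin> (\<lambda>x. x - t k *\<^sub>R v) ` K" for x
        using that by (intro K(2)) (force simp: image_iff)
    qed
    show ?thesis unfolding Q_def using i j integral_translate[of F "t k *\<^sub>R v"] by simp
  qed
  have "(\<lambda>k. \<integral>x. Q k x \<partial>lborel) \<longlonglongrightarrow> (\<integral>x. F' x v \<partial>lborel)"
  proof (rule integral_dominated_convergence[where w = "\<lambda>x. indicator (cball 0 (b + norm v)) x * B"])
    show "(\<lambda>x. F' x v) \<in> borel_measurable lborel"
      using borel_measurable_continuous_onI[OF cont] by simp
    show "integrable lborel (\<lambda>x. indicator (cball (0::'a) (b + norm v)) x * B)"
      using borel_integrable_compact[of "cball (0::'a) (b + norm v)" "\<lambda>_. B"] by simp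
    show "AE x in lborel. (\<lambda>k. Q k x) \<longlonglongrightarrow> F' x v"
    proof (rule AE_I2)
      fix x
      have "((\<lambda>h. (F (x + h *\<^sub>R v) - F x) / h) \<longlongrightarrow> F' x v) (at 0)"
        using line[of x 0] by (simp add: DERIV_def)
      moreover have "filterlim t (at 0) sequentially"
        using tlim t by (intro filterlim_atI) (auto simp: less_le[of 0] eventually_sequentially intro: exI[of _ 0])
      ultimately show "(\<lambda>k. Q k x) \<longlonglongrightarrow> F' x v"
        unfolding Q_def by (rule filterlim_compose)
    qed
    show "AE x in lborel. norm (Q k x) \<le> indicator (cball 0 (b + norm v)) x * B" for k
    proof (rule AE_I2)
      fix x
      show "norm (Q k x) \<le> indicator (cball 0 (b + norm v)) x * B"
      proof (cases "x \<in> cball 0 (b + norm v)")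
        case True
        obtain \<xi> where "0 < \<xi>" "\<xi> < t k"
          "F (x + t k *\<^sub>R v) - F (x + 0 *\<^sub>R v) = (t k - 0) * F' (x + \<xi> *\<^sub>R v) v"
          using MVT2[of 0 "t k" "\<lambda>\<xi>. F (x + \<xi> *\<^sub>R v)" "\<lambda>\<xi>. F' (x + \<xi> *\<^sub>R v) v"] line t by blast
        then have "Q k x = F' (x + \<xi> *\<^sub>R v) v" using t(1)[of k] by (simp add: Q_def)
        then show ?thesis using B True by simp
      next
        case False
        have "norm (t k *\<^sub>R v) \<le> norm v" using t[of k] by (simp add: mult_left_le_one_le)
        then have "\<not> norm (x + t k *\<^sub>R v) \<le> b"
          using False norm_triangle_ineq4[of "x + t k *\<^sub>R v" "t k *\<^sub>R v"] by simp
        moreover have "\<not> norm x \<le> b" using False norm_ge_zero[of v] by (simp del: norm_ge_zero)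
        ultimately have "F (x + t k *\<^sub>R v) = 0" "F x = 0" using b K(2) by blast+
        then show ?thesis using False by (simp add: Q_def)
      qed
    qed
  qed auto
  then show ?thesis using Q0 by (simp add: LIMSEQ_const_iff)
qed

text \<open>
  The integrand is the divergence of the vector field \<open>\<Phi> x *\<^sub>R x\<close>: its component
  along a basis vector \<open>b\<close> is \<open>(x \<bullet> b) * \<Phi> x\<close>, whose derivative in
  direction \<open>b\<close> integrates to zero.
\<close>

lemma integral_divergence_radial_zero:
  fixes \<Phi> :: "'a::euclidean_space \<Rightarrow> real"
  assumes der: "\<And>x. (\<Phi> has_derivative \<Phi>' x) (at x)"
    and cont: "\<And>v. continuous_on UNIV (\<lambda>x. \<Phi>' x v)"
    and K: "compact K" "\<And>x. x \<notin> K \<Longrightarrow> \<Phi> x = 0"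
  shows "(\<integral>x. DIM('a) * \<Phi> x + \<Phi>' x x \<partial>lborel) = 0"
proof -
  have contF: "continuous_on UNIV \<Phi>"
    using der by (intro continuous_at_imp_continuous_on ballI has_derivative_continuous) blast
  have K': "\<Phi>' x v = 0" if "x \<notin> K" for x v
    using derivative_zero_off_support[OF K der] that by simp
  let ?d = "\<lambda>b x. \<Phi> x + (x \<bullet> b) * \<Phi>' x b"
  have "(\<integral>x. ?d b x \<partial>lborel) = 0" if "b \<in> Basis" for b
  proof -
    let ?F' = "\<lambda>x v. (x \<bullet> b) * \<Phi>' x v + (v \<bullet> b) * \<Phi> x"
    have "(\<integral>x. ?F' x b \<partial>lborel) = 0"
    proof (rule integral_directional_derivative_zero[where F' = ?F' and F = "\<lambda>x. (x \<bullet> b) * \<Phi> x" and K = K])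
      show "((\<lambda>x. (x \<bullet> b) * \<Phi> x) has_derivative ?F' x) (at x)" for x
        by (rule has_derivative_mult[OF has_derivative_inner_left[OF has_derivative_ident] der])
      show "continuous_on UNIV (\<lambda>x. ?F' x b)"
        by (intro continuous_intros cont contF)
    qed (use K in auto)
    then show ?thesis using that by (simp add: algebra_simps)
  qed
  moreover have "integrable lborel (?d b)" for b
    by (rule integrable_compact_support[OF K(1)]) (use K K' in \<open>auto intro!: continuous_intros cont contF\<close>)
  ultimately have "(\<integral>x. (\<Sum>b\<in>Basis. ?d b x) \<partial>lborel) = 0"
    by simp
  moreover have "(\<Sum>b\<in>Basis. ?d b x) = DIM('a) * \<Phi> x + \<Phi>' x x" for x
  proof -
    have "linear (\<Phi>' x)" using der by (rule has_derivative_linear)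
    then have "(\<Sum>b\<in>Basis. (x \<bullet> b) * \<Phi>' x b) = \<Phi>' x (\<Sum>b\<in>Basis. (x \<bullet> b) *\<^sub>R b)"
      by (simp add: linear_sum linear_cmul)
    then show ?thesis by (simp add: sum.distrib euclidean_representation)
  qed
  ultimately show ?thesis by simp
qed

section \<open>Hardy inequalities from radial vector fields\<close>

lemma continuous_on_abs_powr_sgn:
  fixes a :: real
  assumes "a > 0"
  shows "continuous_on UNIV (\<lambda>y::real. \<bar>y\<bar> powr a * sgn y)"
proof -
  have "(\<lambda>y::real. \<bar>y\<bar> powr a * sgn y) = (\<lambda>y. max y 0 powr a - max (- y) 0 powr a)"
    by (auto simp: fun_eq_iff sgn_if)
  moreover have "continuous_on UNIV (\<lambda>y::real. max y 0 powr a - max (- y) 0 powr a)"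
    using assms by (intro continuous_intros continuous_on_powr') auto
  ultimately show ?thesis by (simp only:)
qed

text \<open>
  The derivative is written with \<open>sgn\<close> rather than as
  \<open>p * \<bar>y\<bar> powr (p - 2) * y\<close>, so that its continuity at \<open>0\<close> follows from
  the lemma above.
\<close>

lemma has_real_derivative_abs_powr:
  fixes p y :: real
  assumes "p > 1"
  shows "((\<lambda>y. \<bar>y\<bar> powr p) has_real_derivative p * (\<bar>y\<bar> powr (p - 1) * sgn y)) (at y)"
proof (cases "y = 0")
  case False
  have "(abs has_real_derivative sgn y) (at y)"
    using has_derivative_norm[OF False]
    unfolding has_field_derivative_def real_norm_def[abs_def]
    by (rule has_derivative_eq_rhs) (auto simp: fun_eq_iff)
  then have "((\<lambda>y. \<bar>y\<bar> powr p) has_real_derivative p * \<bar>y\<bar> powr (p - 1) * sgn y) (at y)"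
    using False by (intro DERIV_chain2[where f = "\<lambda>t. t powr p" and g = abs] has_real_derivative_powr) auto
  then show ?thesis by (simp add: mult.assoc)
next
  case True
  have "isCont (\<lambda>h::real. \<bar>h\<bar> powr (p - 1) * sgn h) 0"
    using continuous_on_abs_powr_sgn[of "p - 1"] assms by (simp add: continuous_on_eq_continuous_at)
  then have "((\<lambda>h. \<bar>h\<bar> powr (p - 1) * sgn h) \<longlongrightarrow> (\<bar>0\<bar> powr (p - 1) * sgn 0)) (at (0::real))"
    unfolding isCont_def .
  moreover have "\<bar>h\<bar> powr (p - 1) * sgn h = \<bar>h\<bar> powr p / h" for h :: real
    using assms by (cases "h = 0") (auto simp: sgn_if powr_diff)
  ultimately show ?thesis using True assms by (simp add: DERIV_def)
qed

text \<open>
  Young's inequality for the pair \<open>b\<close> and \<open>a powr (p - 1) * c\<close>; below,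
  \<open>a\<close> is \<open>\<bar>u\<bar>\<close>, \<open>b\<close> is \<open>\<bar>grad u\<bar>\<close>
  and \<open>c\<close> is the length of a vector field.
\<close>

lemma Young_scaled:
  fixes p a b c :: real
  assumes "p > 1" "a \<ge> 0" "b \<ge> 0" "c \<ge> 0"
  shows "p * (a powr (p - 1) * b * c) \<le> b powr p + (p - 1) * (a powr p * c powr (p / (p - 1)))"
proof -
  let ?m = "p / (p - 1)"
  have "b * (a powr (p - 1) * c) \<le> b powr p / p + (a powr (p - 1) * c) powr ?m / ?m"
    using assms by (intro Youngs_inequality) (auto simp: field_simps)
  moreover have "(a powr (p - 1) * c) powr ?m = a powr p * c powr ?m"
    using assms by (simp add: powr_mult powr_powr)
  ultimately show ?thesis using assms by (simp add: field_simps)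
qed

text \<open>
  Every radial vector field \<open>\<eta> (norm x) *\<^sub>R x\<close> gives a Hardy inequality. Its
  divergence is \<open>n \<eta> + \<rho> \<eta>'\<close> at distance \<open>\<rho>\<close> from the origin,
  and its length is \<open>\<rho> \<bar>\<eta>\<bar>\<close>. The field multiplied by
  \<open>\<bar>u\<bar> powr p\<close> has a divergence with integral zero, and by the product rule this
  divergence consists of \<open>\<bar>u\<bar> powr p\<close> times that of the field and a term linear in
  the gradient of \<open>u\<close>. Young's inequality splits the latter into the \<open>p\<close>-th power
  of the gradient and the last summand of the bound on \<open>w\<close>. The field is only required on a
  punctured ball containing the support of \<open>u\<close>, which lets \<open>\<eta>\<close> involve
  logarithms.
\<close>

theorem Hardy_inequality_radial_field:
  fixes u :: "'a::euclidean_space \<Rightarrow> real" and G :: "'a \<Rightarrow> 'a" and \<eta> \<eta>' w :: "real \<Rightarrow> real" and p M :: real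
  assumes "p > 1"
    and der: "\<And>x. (u has_derivative (\<lambda>v. G x \<bullet> v)) (at x)"
    and cont: "continuous_on UNIV G"
    and K: "compact K" "\<And>x. x \<notin> K \<Longrightarrow> u x = 0" "\<And>x. x \<in> K \<Longrightarrow> 0 < norm x \<and> norm x < M"
    and \<eta>: "\<And>\<rho>. 0 < \<rho> \<Longrightarrow> \<rho> < M \<Longrightarrow> (\<eta> has_real_derivative \<eta>' \<rho>) (at \<rho>)"
    and \<eta>': "continuous_on {0<..<M} \<eta>'"
    and w: "continuous_on {0<..<M} w"
      "\<And>\<rho>. 0 < \<rho> \<Longrightarrow> \<rho> < M \<Longrightarrow>
         w \<rho> \<le> DIM('a) * \<eta> \<rho> + \<rho> * \<eta>' \<rho> - (p - 1) * (\<rho> * \<bar>\<eta> \<rho>\<bar>) powr (p / (p - 1))"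
  shows "integrable lborel (\<lambda>x. \<bar>u x\<bar> powr p * w (norm x))"
    and "(\<integral>x. \<bar>u x\<bar> powr p * w (norm x) \<partial>lborel) \<le> (\<integral>x. norm (G x) powr p \<partial>lborel)"
proof -
  \<comment> \<open>All integrands are continuous on this open set and vanish outside \<open>K\<close>, hence are continuous everywhere.\<close>
  define U where "U = {x::'a. 0 < norm x \<and> norm x < M}"
  have "U = - {0} \<inter> ball 0 M" by (auto simp: U_def)
  then have "open U" by (auto intro!: open_Int)
  have KU: "closed K" "K \<subseteq> U" using K by (auto simp: U_def compact_imp_closed)
  have contu: "continuous_on UNIV u"
    using der by (intro continuous_at_imp_continuous_on ballI has_derivative_continuous) blast
  have contup: "continuous_on S (\<lambda>x. \<bar>u x\<bar> powr p)" for S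
    using \<open>p > 1\<close> by (intro continuous_on_powr' continuous_intros continuous_on_subset[OF contu]) auto
  have contus: "continuous_on S (\<lambda>x. \<bar>u x\<bar> powr (p - 1) * sgn (u x))" for S
    using \<open>p > 1\<close> continuous_on_compose2[OF continuous_on_abs_powr_sgn[of "p - 1"] contu]
    by (auto intro: continuous_on_subset)
  have "continuous_on {0<..<M} \<eta>"
    using \<eta> by (intro continuous_at_imp_continuous_on ballI DERIV_isCont) auto
  then have cont\<eta>: "continuous_on U (\<lambda>x. \<eta> (norm x))"
    by (rule continuous_on_compose2) (auto simp: U_def intro!: continuous_intros)
  have cont\<eta>': "continuous_on U (\<lambda>x. \<eta>' (norm x))"
    by (rule continuous_on_compose2[OF \<eta>']) (auto simp: U_def intro!: continuous_intros)
  have G0: "G x = 0" if "x \<notin> K" for x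
  proof -
    have "(\<lambda>v. G x \<bullet> v) = (\<lambda>_. 0)"
      by (rule derivative_zero_off_support[OF K(1,2) der that])
    then have "G x \<bullet> G x = 0" by meson
    then show ?thesis by simp
  qed
  define \<Phi> where "\<Phi> x = \<bar>u x\<bar> powr p * \<eta> (norm x)" for x
  define \<Phi>' where "\<Phi>' x v = \<bar>u x\<bar> powr p * (\<eta>' (norm x) * ((x \<bullet> v) / norm x))
      + p * (\<bar>u x\<bar> powr (p - 1) * sgn (u x)) * (G x \<bullet> v) * \<eta> (norm x)" for x v
  have der\<Phi>: "(\<Phi> has_derivative \<Phi>' x) (at x)" for x
  proof (cases "x \<in> K")
    case True
    then have x: "0 < norm x" "norm x < M" using K by auto
    have "((\<lambda>x. \<eta> (norm x)) has_derivative (\<lambda>v. \<eta>' (norm x) * ((x \<bullet> v) / norm x))) (at x)"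
    proof -
      have "(norm has_derivative (\<lambda>v. (x \<bullet> v) / norm x)) (at x)"
        using has_derivative_norm[of x] x by (simp add: sgn_div_norm inner_commute divide_inverse mult.commute)
      from has_derivative_compose[OF this \<eta>[OF x, unfolded has_field_derivative_def]]
      show ?thesis .
    qed
    moreover have "((\<lambda>x. \<bar>u x\<bar> powr p) has_derivative
        (\<lambda>v. p * (\<bar>u x\<bar> powr (p - 1) * sgn (u x)) * (G x \<bullet> v))) (at x)"
      using has_derivative_compose[OF der has_real_derivative_abs_powr[OF \<open>p > 1\<close>, unfolded has_field_derivative_def]] .
    ultimately show ?thesis unfolding \<Phi>_def \<Phi>'_def
      by (rule has_derivative_mult[rotated])
  next
    case False
    have "open (- K)" using KU by (simp add: open_Compl)
    then have "(\<Phi> has_derivative (\<lambda>_. 0)) (at x)"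
      using False K(2)
      by (intro has_derivative_transform_within_open[of "\<lambda>_. 0" _ x UNIV "- K" \<Phi>]) (auto simp: \<Phi>_def)
    moreover have "\<Phi>' x = (\<lambda>_. 0)" using False K(2) by (simp add: \<Phi>'_def fun_eq_iff)
    ultimately show ?thesis by simp
  qed
  have cont\<Phi>': "continuous_on UNIV (\<lambda>x. \<Phi>' x v)" for v
  proof (rule continuous_on_extend_by_zero[OF \<open>open U\<close> KU])
    show "continuous_on U (\<lambda>x. \<Phi>' x v)" unfolding \<Phi>'_def
      by (intro continuous_intros contup contus cont\<eta> cont\<eta>' continuous_on_subset[OF cont]) (auto simp: U_def)
    show "\<Phi>' x v = 0" if "x \<notin> K" for x using that K(2) by (simp add: \<Phi>'_def)
  qed
  have \<Phi>0: "\<Phi> x = 0" if "x \<notin> K" for x using that K(2) by (simp add: \<Phi>_def)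
  let ?div = "\<lambda>x. DIM('a) * \<Phi> x + \<Phi>' x x"
  have div0: "(\<integral>x. ?div x \<partial>lborel) = 0"
    by (rule integral_divergence_radial_zero[OF der\<Phi> cont\<Phi>' K(1) \<Phi>0])
  have contD: "continuous_on UNIV (\<lambda>x. \<Phi>' x x)"
  proof (rule continuous_on_extend_by_zero[OF \<open>open U\<close> KU])
    show "continuous_on U (\<lambda>x. \<Phi>' x x)" unfolding \<Phi>'_def
      by (intro continuous_intros contup contus cont\<eta> cont\<eta>' continuous_on_subset[OF cont]) (auto simp: U_def)
    show "\<Phi>' x x = 0" if "x \<notin> K" for x using that K(2) by (simp add: \<Phi>'_def)
  qed
  have int_div: "integrable lborel ?div"
  proof (rule integrable_compact_support[OF K(1)])
    have "continuous_on UNIV \<Phi>"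
      using der\<Phi> by (intro continuous_at_imp_continuous_on ballI has_derivative_continuous) blast
    then show "continuous_on UNIV ?div" by (intro continuous_intros contD)
    show "?div x = 0" if "x \<notin> K" for x using that K(2) by (simp add: \<Phi>_def \<Phi>'_def)
  qed
  have int_G: "integrable lborel (\<lambda>x. norm (G x) powr p)"
  proof (rule integrable_compact_support[OF K(1)])
    show "continuous_on UNIV (\<lambda>x. norm (G x) powr p)"
      using \<open>p > 1\<close> by (intro continuous_on_powr' continuous_intros cont) auto
  qed (use G0 in auto)
  have cont_w: "continuous_on U (\<lambda>x. w (norm x))"
    by (rule continuous_on_compose2[OF w(1)]) (auto simp: U_def intro!: continuous_intros)
  show int_w: "integrable lborel (\<lambda>x. \<bar>u x\<bar> powr p * w (norm x))"
  proof (rule integrable_compact_support[OF K(1)])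
    show "continuous_on UNIV (\<lambda>x. \<bar>u x\<bar> powr p * w (norm x))"
      by (rule continuous_on_extend_by_zero[OF \<open>open U\<close> KU])
        (use K(2) in \<open>auto intro!: continuous_intros contup cont_w\<close>)
  qed (use K(2) in auto)
  have pointwise: "\<bar>u x\<bar> powr p * w (norm x) \<le> ?div x + norm (G x) powr p" for x
  proof (cases "x \<in> K")
    case True
    then have x: "norm x > 0" "norm x < M" using K by auto
    let ?W = "DIM('a) * \<eta> (norm x) + norm x * \<eta>' (norm x)
      - (p - 1) * (norm x * \<bar>\<eta> (norm x)\<bar>) powr (p / (p - 1))"
    have "- (p * (\<bar>u x\<bar> powr (p - 1) * sgn (u x)) * (G x \<bullet> x) * \<eta> (norm x))
        \<le> \<bar>p * (\<bar>u x\<bar> powr (p - 1) * sgn (u x)) * (G x \<bullet> x) * \<eta> (norm x)\<bar>" by linarith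
    also have "\<dots> = p * (\<bar>u x\<bar> powr (p - 1) * \<bar>sgn (u x)\<bar> * \<bar>G x \<bullet> x\<bar> * \<bar>\<eta> (norm x)\<bar>)"
      using \<open>p > 1\<close> by (simp add: abs_mult)
    also have "\<dots> \<le> p * (\<bar>u x\<bar> powr (p - 1) * 1 * (norm (G x) * norm x) * \<bar>\<eta> (norm x)\<bar>)"
      using \<open>p > 1\<close> by (intro mult_left_mono mult_right_mono mult_mono Cauchy_Schwarz_ineq2) (auto simp: sgn_if)
    also have "\<dots> = p * (\<bar>u x\<bar> powr (p - 1) * norm (G x) * (norm x * \<bar>\<eta> (norm x)\<bar>))" by simp
    also have "\<dots> \<le> norm (G x) powr p
        + (p - 1) * (\<bar>u x\<bar> powr p * (norm x * \<bar>\<eta> (norm x)\<bar>) powr (p / (p - 1)))"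
      using \<open>p > 1\<close> by (intro Young_scaled) auto
    finally have "\<bar>u x\<bar> powr p * ?W \<le> ?div x + norm (G x) powr p" using x
      by (simp add: \<Phi>_def \<Phi>'_def algebra_simps flip: power2_norm_eq_inner)
         (simp add: power2_eq_square)
    moreover have "\<bar>u x\<bar> powr p * w (norm x) \<le> \<bar>u x\<bar> powr p * ?W"
      using w(2)[OF x] by (intro mult_left_mono) auto
    ultimately show ?thesis by linarith
  next
    case False
    then show ?thesis using K(2) by (simp add: \<Phi>_def \<Phi>'_def)
  qed
  have "(\<integral>x. \<bar>u x\<bar> powr p * w (norm x) \<partial>lborel) \<le> (\<integral>x. ?div x + norm (G x) powr p \<partial>lborel)"
    by (intro integral_mono int_w Bochner_Integration.integrable_add int_div int_G pointwise)
  also have "\<dots> = (\<integral>x. norm (G x) powr p \<partial>lborel)"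
    using Bochner_Integration.integral_add[OF int_div int_G] div0 by simp
  finally show "(\<integral>x. \<bar>u x\<bar> powr p * w (norm x) \<partial>lborel) \<le> (\<integral>x. norm (G x) powr p \<partial>lborel)" .
qed

section \<open>Hardy inequality with a remainder concentrated at one scale\<close>

text \<open>
  The function on the right has a maximum at \<open>\<phi> = 1\<close> with value \<open>1\<close>; losing
  only a quadratic term near the maximum is what makes a logarithmic improvement of Hardy's inequality
  possible. With \<open>\<alpha> = 1 / (p - 1) \<le> 1\<close> the power
  \<open>\<phi> powr (1 + \<alpha>)\<close> is \<open>\<phi> * \<phi> powr \<alpha>\<close>, and
  \<open>\<phi> powr \<alpha>\<close> lies below its tangent at \<open>1\<close>.
\<close>

lemma powr_conjugate_quadratic_bound:
  fixes p \<phi> :: real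
  assumes "p \<ge> 2" "\<phi> \<ge> 0"
  shows "1 - (1 - \<phi>)\<^sup>2 \<le> p * \<phi> - (p - 1) * \<phi> powr (p / (p - 1))"
proof (cases "\<phi> = 0")
  case False
  then have "\<phi> > 0" using assms by simp
  define \<alpha> where "\<alpha> = 1 / (p - 1)"
  have \<alpha>: "0 \<le> \<alpha>" "\<alpha> \<le> 1" "(p - 1) * \<alpha> = 1" "p / (p - 1) = 1 + \<alpha>"
    using assms by (auto simp: \<alpha>_def field_simps)
  have "\<phi> powr \<alpha> * 1 powr (1 - \<alpha>) \<le> \<alpha> * \<phi> + (1 - \<alpha>) * 1"
    using \<alpha> \<open>\<phi> > 0\<close> by (intro Youngs_inequality_0) auto
  then have "(p - 1) * \<phi> * \<phi> powr \<alpha> \<le> (p - 1) * \<phi> * (\<alpha> * \<phi> + (1 - \<alpha>))"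
    using assms \<open>\<phi> > 0\<close> by (intro mult_left_mono) auto
  also have "\<dots> = ((p - 1) * \<alpha>) * \<phi>\<^sup>2 + ((p - 1) - (p - 1) * \<alpha>) * \<phi>"
    by (simp add: algebra_simps power2_eq_square)
  also have "\<dots> = \<phi>\<^sup>2 + (p - 2) * \<phi>" unfolding \<alpha>(3) by simp
  finally have "(p - 1) * \<phi> powr (1 + \<alpha>) \<le> \<phi>\<^sup>2 + (p - 2) * \<phi>"
    using \<open>\<phi> > 0\<close> by (simp add: powr_add mult.assoc)
  then show ?thesis unfolding \<alpha>(4) by (simp add: power2_eq_square algebra_simps)
qed auto

text \<open>
  The field with \<open>\<eta> \<rho> = - (H powr (p - 1)) * \<rho> powr (- p)\<close> gives the sharp Hardy
  inequality. Multiplying it by \<open>1 - 1 / g\<close>, where \<open>g\<close> is the expression that is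
  squared in the denominator of \<open>h\<close>, gains, in units of \<open>(H / \<rho>) powr p\<close>, the
  amount \<open>(- \<rho> g' / H) / g\<^sup>2\<close> through the divergence and loses at most
  \<open>1 / g\<^sup>2\<close> by \<open>powr_conjugate_quadratic_bound\<close>. With \<open>g\<close> equal
  to \<open>H * (1 + ln (D / \<rho>)) + 1\<close> gain and loss cancel. The additional summand of
  \<open>g\<close>, a step of height \<open>s\<close> at the scale \<open>R\<close> smoothed by the exponent
  \<open>\<beta>\<close>, leaves the surplus \<open>h\<close>. If \<open>s\<close> is of the size of
  \<open>1 + ln (D / R)\<close>, then so is \<open>g\<close> near \<open>\<rho> = R\<close>, and the surplus
  there is of order \<open>1 / s\<close>.
\<close>

theorem improved_Hardy_inequality:
  fixes u :: "'a::euclidean_space \<Rightarrow> real" and G :: "'a \<Rightarrow> 'a" and p H D R s \<beta> :: real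
  assumes p: "p > DIM('a)" "p \<ge> 2"
    and der: "\<And>x. (u has_derivative (\<lambda>v. G x \<bullet> v)) (at x)"
    and cont: "continuous_on UNIV G"
    and K: "compact K" "\<And>x. x \<notin> K \<Longrightarrow> u x = 0" "\<And>x. x \<in> K \<Longrightarrow> 0 < norm x \<and> norm x \<le> D"
    and pos: "0 < D" "0 < R" "0 \<le> s" "0 < \<beta>"
  defines "H \<equiv> (p - DIM('a)) / p"
    and "h \<equiv> \<lambda>\<rho>. s * \<beta> * (\<rho> / R) powr \<beta> / (1 + (\<rho> / R) powr \<beta>)\<^sup>2
                / (H * (H * (1 + ln (D / \<rho>)) + 1 + s / (1 + (\<rho> / R) powr \<beta>))\<^sup>2)"
  shows "integrable lborel (\<lambda>x. \<bar>u x\<bar> powr p / norm x powr p * (1 + h (norm x)))"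
    and "H powr p * (\<integral>x. \<bar>u x\<bar> powr p / norm x powr p * (1 + h (norm x)) \<partial>lborel)
         \<le> (\<integral>x. norm (G x) powr p \<partial>lborel)"
proof -
  have H: "0 < H" "p * H = p - DIM('a)" using p by (auto simp: H_def)
  define y where "y \<rho> = (\<rho> / R) powr \<beta>" for \<rho>
  define g where "g \<rho> = H * (1 + ln (D / \<rho>)) + 1 + s / (1 + (\<rho> / R) powr \<beta>)" for \<rho>
  define k where "k \<rho> = s * \<beta> * y \<rho> / (1 + y \<rho>)\<^sup>2" for \<rho>
  define \<phi> where "\<phi> \<rho> = 1 - 1 / g \<rho>" for \<rho>
  define \<eta> where "\<eta> \<rho> = - (H powr (p - 1)) * (\<rho> powr (- p) * \<phi> \<rho>)" for \<rho>
  define \<eta>' where "\<eta>' \<rho> = H powr (p - 1) *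
      (p * \<rho> powr (- p - 1) * \<phi> \<rho> + \<rho> powr (- p) * ((H + k \<rho>) / \<rho> / (g \<rho>)\<^sup>2))" for \<rho>
  have y0: "0 \<le> y \<rho>" for \<rho> by (simp add: y_def)
  have k0: "0 \<le> k \<rho>" for \<rho> using y0 pos by (simp add: k_def)
  \<comment> \<open>The logarithm in \<open>g\<close> is used slightly beyond \<open>D\<close>, to have an open interval around all \<open>norm x\<close>;
    \<open>2 * D\<close> works because \<open>ln 2 < 1\<close>.\<close>
  have g1: "1 < g \<rho>" if "0 < \<rho>" "\<rho> < 2 * D" for \<rho>
  proof -
    have "ln (1/2) \<le> ln (D / \<rho>)" using that pos by (subst ln_le_cancel_iff) (auto simp: field_simps)
    moreover have "ln 2 < (1::real)" by (rule ln_2_less_1)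
    ultimately have "0 < 1 + ln (D / \<rho>)" by (simp add: ln_div)
    moreover have "0 \<le> s / (1 + (\<rho> / R) powr \<beta>)" using pos by (intro divide_nonneg_pos add_pos_nonneg) auto
    ultimately show ?thesis using H by (simp add: g_def add_pos_nonneg)
  qed
  have der_g: "(g has_real_derivative - (H + k \<rho>) / \<rho>) (at \<rho>)" if "0 < \<rho>" for \<rho>
  proof -
    have y1: "1 + (\<rho> / R) powr \<beta> \<noteq> 0" using y0[of \<rho>] unfolding y_def by linarith
    have dy: "((\<lambda>\<rho>. (\<rho> / R) powr \<beta>) has_real_derivative \<beta> * y \<rho> / \<rho>) (at \<rho>)"
      using that pos unfolding y_def
      by (auto intro!: derivative_eq_intros simp: powr_diff field_simps)
    have dl: "((\<lambda>\<rho>. ln (D / \<rho>)) has_real_derivative - 1 / \<rho>) (at \<rho>)"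
      using that pos by (auto intro!: derivative_eq_intros simp: field_simps power2_eq_square)
    have ds: "((\<lambda>\<rho>. s / (1 + (\<rho> / R) powr \<beta>)) has_real_derivative - k \<rho> / \<rho>) (at \<rho>)"
      by (rule DERIV_cong[OF DERIV_divide[OF DERIV_const DERIV_add[OF DERIV_const dy] y1]])
        (simp add: k_def y_def power2_eq_square mult_ac)
    show ?thesis unfolding g_def
      by (rule DERIV_cong[OF DERIV_add[OF DERIV_add[OF DERIV_cmult[OF DERIV_add[OF DERIV_const dl]] DERIV_const] ds]])
        (use that in \<open>simp add: field_simps\<close>)
  qed
  have der_\<eta>: "(\<eta> has_real_derivative \<eta>' \<rho>) (at \<rho>)" if "0 < \<rho>" "\<rho> < 2 * D" for \<rho>
  proof -
    have g0: "g \<rho> \<noteq> 0" using g1[OF that] by simp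
    have d1: "(\<phi> has_real_derivative - ((H + k \<rho>) / \<rho> / (g \<rho>)\<^sup>2)) (at \<rho>)" unfolding \<phi>_def
      by (rule DERIV_cong[OF DERIV_diff[OF DERIV_const DERIV_divide[OF DERIV_const der_g[OF that(1)] g0]]])
        (use that g0 in \<open>simp add: power2_eq_square field_simps\<close>)
    have d2: "((\<lambda>\<rho>. \<rho> powr (- p)) has_real_derivative - p * \<rho> powr (- p - 1)) (at \<rho>)"
      using that(1) by (rule has_real_derivative_powr)
    define E where "E = (H + k \<rho>) / \<rho> / (g \<rho>)\<^sup>2"
    have "(\<eta> has_real_derivative - (H powr (p - 1)) *
        (- p * \<rho> powr (- p - 1) * \<phi> \<rho> + - E * \<rho> powr (- p))) (at \<rho>)"
      unfolding \<eta>_def E_def by (rule DERIV_cmult[OF DERIV_mult[OF d2 d1]])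
    then show ?thesis unfolding \<eta>'_def E_def[symmetric] by (simp add: algebra_simps)
  qed
  have cont_g: "continuous_on {0<..<2 * D} g"
    using der_g by (intro continuous_at_imp_continuous_on ballI DERIV_isCont) auto
  have cont_y: "continuous_on {0<..<2 * D} y"
    unfolding y_def using pos by (intro continuous_intros) auto
  have cont_k: "continuous_on {0<..<2 * D} k"
    unfolding k_def using y0
    by (intro continuous_intros cont_y) (metis add_pos_nonneg power_not_zero zero_less_one less_irrefl)
  have "continuous_on {0<..<2 * D} \<phi>"
    unfolding \<phi>_def using g1 by (intro continuous_intros cont_g) force
  with cont_k have cont_\<eta>': "continuous_on {0<..<2 * D} \<eta>'"
    unfolding \<eta>'_def using g1 by (intro continuous_intros cont_g) force+
  define w where "w \<rho> = H powr p * (1 / \<rho> powr p * (1 + k \<rho> / (H * (g \<rho>)\<^sup>2)))" for \<rho>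
  have cont_w: "continuous_on {0<..<2 * D} w"
    unfolding w_def using g1 H cont_k by (intro continuous_intros cont_g) force+
  have w_eq: "\<bar>u x\<bar> powr p * w (norm x) = H powr p * (\<bar>u x\<bar> powr p / norm x powr p * (1 + h (norm x)))" for x
    by (simp add: w_def h_def k_def g_def y_def)
  have lower: "w \<rho>
      \<le> DIM('a) * \<eta> \<rho> + \<rho> * \<eta>' \<rho> - (p - 1) * (\<rho> * \<bar>\<eta> \<rho>\<bar>) powr (p / (p - 1))"
    if \<rho>: "0 < \<rho>" "\<rho> < 2 * D" for \<rho>
  proof -
    have g: "1 < g \<rho>" by (rule g1[OF \<rho>])
    then have \<phi>: "0 \<le> \<phi> \<rho>" "(1 - \<phi> \<rho>)\<^sup>2 = 1 / (g \<rho>)\<^sup>2"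
      by (auto simp: \<phi>_def field_simps)
    have Hp: "H powr p = H powr (p - 1) * H" using H by (simp add: powr_diff)
    have "(\<rho> * \<bar>\<eta> \<rho>\<bar>) powr (p / (p - 1)) = ((H / \<rho>) powr (p - 1) * \<phi> \<rho>) powr (p / (p - 1))"
      using \<rho> H \<phi> by (simp add: \<eta>_def abs_mult powr_divide powr_diff powr_minus field_simps)
    also have "\<dots> = (H / \<rho>) powr p * \<phi> \<rho> powr (p / (p - 1))"
      using \<rho> H \<phi> p by (simp add: powr_mult powr_powr)
    finally have *: "(\<rho> * \<bar>\<eta> \<rho>\<bar>) powr (p / (p - 1)) = H powr p / \<rho> powr p * \<phi> \<rho> powr (p / (p - 1))"
      using \<rho> H by (simp add: powr_divide)
    have "\<rho> * \<eta>' \<rho> = H powr (p - 1) / \<rho> powr p * (p * \<phi> \<rho> + (H + k \<rho>) / (g \<rho>)\<^sup>2)"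
    proof -
      have 1: "\<rho> * \<rho> powr (- p - 1) = 1 / \<rho> powr p"
        using \<rho> by (simp add: powr_diff powr_minus field_simps)
      have 2: "\<rho> * ((H + k \<rho>) / \<rho> / (g \<rho>)\<^sup>2) = (H + k \<rho>) / (g \<rho>)\<^sup>2" using \<rho> by simp
      have 3: "\<rho> powr (- p) = 1 / \<rho> powr p" by (simp add: powr_minus inverse_eq_divide)
      have "\<rho> * \<eta>' \<rho> = H powr (p - 1) * (p * (\<rho> * \<rho> powr (- p - 1)) * \<phi> \<rho>
          + \<rho> powr (- p) * (\<rho> * ((H + k \<rho>) / \<rho> / (g \<rho>)\<^sup>2)))"
        unfolding \<eta>'_def by (simp only: distrib_left mult_ac)
      then show ?thesis unfolding 1 2 3 by (simp add: distrib_left)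
    qed
    then have "DIM('a) * \<eta> \<rho> + \<rho> * \<eta>' \<rho>
        = H powr (p - 1) / \<rho> powr p * ((p - DIM('a)) * \<phi> \<rho> + (H + k \<rho>) / (g \<rho>)\<^sup>2)"
      using \<rho> by (simp add: \<eta>_def powr_minus field_simps)
    also have "\<dots> = H powr p / \<rho> powr p * (p * \<phi> \<rho> + (1 + k \<rho> / H) / (g \<rho>)\<^sup>2)"
      using \<rho> H g by (simp add: Hp flip: H(2)) (simp add: field_simps)
    finally have **: "DIM('a) * \<eta> \<rho> + \<rho> * \<eta>' \<rho>
        = H powr p / \<rho> powr p * (p * \<phi> \<rho> + (1 + k \<rho> / H) / (g \<rho>)\<^sup>2)" .
    have "c * (P + Z) - (p - 1) * (c * Y) = c * ((P - (p - 1) * Y) + Z)" for c P Y Z :: real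
      by (simp add: algebra_simps)
    then have "DIM('a) * \<eta> \<rho> + \<rho> * \<eta>' \<rho> - (p - 1) * (\<rho> * \<bar>\<eta> \<rho>\<bar>) powr (p / (p - 1))
        = H powr p / \<rho> powr p * ((p * \<phi> \<rho> - (p - 1) * \<phi> \<rho> powr (p / (p - 1))) + (1 + k \<rho> / H) / (g \<rho>)\<^sup>2)"
      unfolding * ** by blast
    also have "\<dots> \<ge> H powr p / \<rho> powr p * ((1 - (1 - \<phi> \<rho>)\<^sup>2) + (1 + k \<rho> / H) / (g \<rho>)\<^sup>2)"
      using powr_conjugate_quadratic_bound[OF p(2) \<phi>(1)] by (intro mult_left_mono add_right_mono) auto
    finally show ?thesis unfolding w_def \<phi>(2) by (simp add: add_divide_distrib algebra_simps)
  qed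
  have K': "0 < norm x \<and> norm x < 2 * D" if "x \<in> K" for x
    using K(3)[OF that] pos by auto
  have "p > 1" using p by simp
  note field = Hardy_inequality_radial_field[OF this der cont K(1,2) K' der_\<eta> cont_\<eta>' cont_w lower]
  show "integrable lborel (\<lambda>x. \<bar>u x\<bar> powr p / norm x powr p * (1 + h (norm x)))"
    using field(1) H unfolding w_eq integrable_mult_left_iff by simp
  show "H powr p * (\<integral>x. \<bar>u x\<bar> powr p / norm x powr p * (1 + h (norm x)) \<partial>lborel)
         \<le> (\<integral>x. norm (G x) powr p \<partial>lborel)"
    using field(2) unfolding w_eq integral_mult_right_zero .
qed

text \<open>
  The right-hand side is the surplus weight of \<open>improved_Hardy_inequality\<close>, with the step
  height \<open>s\<close> tied to the radius \<open>r\<close>. Towards the origin the denominator grows like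
  the square of a logarithm; half of the exponent \<open>\<beta>\<close> absorbs one such logarithm, so that
  at the cost of replacing \<open>\<beta>\<close> by \<open>2 * \<beta>\<close> the weight is of order
  \<open>1 / s\<close> up to a pure power.
\<close>

lemma logarithmic_weight_lower_bound:
  fixes H D R r \<rho> \<beta> :: real
  defines "s \<equiv> 1 + ln (D / r)" and "y \<equiv> (\<rho> / R) powr \<beta>" and "B \<equiv> H + 2 + 2 * H / \<beta>"
  assumes pos: "0 < H" "0 < \<beta>" "0 < \<rho>" "\<rho> \<le> R" "0 < r" "r \<le> R" "\<rho> \<le> D" "r \<le> D"
  shows "\<beta> / (4 * H * B\<^sup>2) / s * (\<rho> / R) powr (2 * \<beta>)
    \<le> s * \<beta> * y / (1 + y)\<^sup>2 / (H * (H * (1 + ln (D / \<rho>)) + 1 + s / (1 + y))\<^sup>2)"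
proof -
  let ?g = "H * (1 + ln (D / \<rho>)) + 1 + s / (1 + y)"
  define e where "e = (\<rho> / R) powr (\<beta> / 2)"
  have ratio: "0 < \<rho> / R" "\<rho> / R \<le> 1" using pos by auto
  have e: "0 < e" "e \<le> 1" using ratio pos by (auto simp: e_def powr_le1)
  have ye: "y = e\<^sup>2" "(\<rho> / R) powr (2 * \<beta>) = y\<^sup>2"
    by (simp_all add: y_def e_def power2_eq_square flip: powr_add)
  have y: "0 < y" "y \<le> 1" using e by (auto simp: ye power_le_one)
  have s: "1 \<le> s" using pos by (simp add: s_def)
  have B: "0 < B" using pos by (simp add: B_def add_pos_pos)
  have "0 \<le> ln (D / \<rho>)" using pos by simp
  moreover have "0 \<le> s / (1 + y)" using s y by simp
  ultimately have g: "1 \<le> ?g" using pos by (simp add: add_nonneg_nonneg)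
  have "ln (R / \<rho>) \<le> (R / \<rho>) powr (\<beta> / 2) / (\<beta> / 2)"
    using pos by (intro ln_powr_bound) auto
  also have "(R / \<rho>) powr (\<beta> / 2) = 1 / e"
    using pos by (simp add: e_def powr_divide)
  finally have lnR: "ln (R / \<rho>) \<le> 2 / (\<beta> * e)" by (simp add: mult.commute)
  have "ln (r / \<rho>) \<le> ln (R / \<rho>)" using pos by (simp add: divide_right_mono)
  moreover have "ln (D / \<rho>) = ln (D / r) + ln (r / \<rho>)"
    using pos by (simp add: ln_div)
  ultimately have "1 + ln (D / \<rho>) \<le> s + 2 / (\<beta> * e)"
    using lnR unfolding s_def by linarith
  then have "H * (1 + ln (D / \<rho>)) \<le> H * (s + 2 / (\<beta> * e))" using pos by (intro mult_left_mono) auto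
  moreover have "s / (1 + y) \<le> s / 1" using s y by (intro divide_left_mono) auto
  ultimately have "?g \<le> H * (s + 2 / (\<beta> * e)) + s + s" using s by simp
  then have "?g * e \<le> (H * (s + 2 / (\<beta> * e)) + s + s) * e"
    using e by (intro mult_right_mono) auto
  also have "\<dots> = (H + 2) * s * e + 2 * H / \<beta> * 1" using e pos by (simp add: field_simps)
  also have "\<dots> \<le> (H + 2) * s * 1 + 2 * H / \<beta> * s"
    using e s pos by (intro add_mono mult_left_mono) auto
  also have "\<dots> = s * B" by (simp add: B_def algebra_simps)
  finally have "?g * e \<le> s * B" .
  then have "(?g * e)\<^sup>2 \<le> (s * B)\<^sup>2" using g e by (intro power_mono mult_nonneg_nonneg) auto
  then have gy: "?g\<^sup>2 * y \<le> s\<^sup>2 * B\<^sup>2" by (simp add: ye power_mult_distrib)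
  have "(1 + y)\<^sup>2 \<le> 2\<^sup>2" using y by (intro power_mono) auto
  then have "(1 + y)\<^sup>2 * (H * (?g\<^sup>2 * y)) \<le> 4 * (H * (s\<^sup>2 * B\<^sup>2))"
    using gy pos y by (intro mult_mono[where b = 4] mult_left_mono) auto
  then have "s * \<beta> * y\<^sup>2 / (4 * (H * (s\<^sup>2 * B\<^sup>2))) \<le> s * \<beta> * y\<^sup>2 / ((1 + y)\<^sup>2 * (H * (?g\<^sup>2 * y)))"
    using s pos y B less_le_trans[OF zero_less_one g]
    by (intro divide_left_mono mult_pos_pos zero_less_power mult_nonneg_nonneg) (auto simp: add_pos_pos)
  moreover have "s * \<beta> * y\<^sup>2 / (4 * (H * (s\<^sup>2 * B\<^sup>2))) = \<beta> / (4 * H * B\<^sup>2) / s * (\<rho> / R) powr (2 * \<beta>)"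
    using s by (simp add: ye(2) power2_eq_square)
  moreover have "s * \<beta> * y\<^sup>2 / (b * (H * (c * y))) = s * \<beta> * y / b / (H * c)" for b c
    using y by (simp add: power2_eq_square)
  ultimately show ?thesis by simp
qed

section \<open>Weighted Hoelder inequality and powers of the norm on balls\<close>

text \<open>
  Hoelder's inequality for \<open>f powr q = (f powr p * w) powr (q / p) * w powr (- (q / p))\<close>, by
  integrating Young's inequality with a free factor \<open>l\<close> and choosing \<open>l\<close>
  optimally. The weight only has to be positive where \<open>f\<close> does not vanish, so both functions
  may be cut off outside a set.
\<close>

lemma Hoelder_weighted:
  fixes f w :: "'a \<Rightarrow> real" and p q :: real
  defines "\<kappa> \<equiv> q / (p - q)"
  assumes "0 < q" "q < p" "\<And>x. 0 \<le> f x" "AE x in M. f x \<noteq> 0 \<longrightarrow> 0 < w x"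
    and int: "integrable M (\<lambda>x. f x powr p * w x)" "integrable M (\<lambda>x. w x powr (- \<kappa>))"
  shows "(\<integral>x. f x powr q \<partial>M)
    \<le> (\<integral>x. f x powr p * w x \<partial>M) powr (q / p) * (\<integral>x. w x powr (- \<kappa>) \<partial>M) powr (1 - q / p)"
proof -
  let ?A = "\<integral>x. f x powr p * w x \<partial>M" and ?B = "\<integral>x. w x powr (- \<kappa>) \<partial>M"
  have p: "0 < p" "0 < \<kappa>" using assms by (auto simp: \<kappa>_def)
  define \<theta> where "\<theta> = q / p"
  have \<theta>: "0 < \<theta>" "\<theta> < 1" "\<kappa> * (1 - \<theta>) = \<theta>" "p * \<theta> = q"
    using \<open>0 < q\<close> \<open>q < p\<close> p by (auto simp: \<theta>_def \<kappa>_def field_simps)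
  \<comment> \<open>Strictly positive upper bounds \<open>J\<close> and \<open>L\<close> avoid dividing by integrals that may vanish.\<close>
  have perturbed: "(\<integral>x. f x powr q \<partial>M) \<le> J powr \<theta> * L powr (1 - \<theta>)"
    if J: "?A \<le> J" "0 < J" and L: "?B \<le> L" "0 < L" for J L
  proof -
    \<comment> \<open>this choice makes the two products \<open>l * J\<close> and \<open>l powr (- \<kappa>) * L\<close> equal\<close>
    define l where "l = (L / J) powr (1 - \<theta>)"
    have l: "0 < l" using J L by (simp add: l_def)
    let ?b = "\<lambda>x. (\<theta> * l) * (f x powr p * w x) + ((1 - \<theta>) * l powr (- \<kappa>)) * w x powr (- \<kappa>)"
    have int_b: "integrable M ?b" using int by simp
    have Young: "AE x in M. f x powr q \<le> ?b x"
      using assms(5)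
    proof eventually_elim
      case (elim x)
      show ?case
      proof (cases "f x = 0")
        case True
        then show ?thesis using \<theta> l by simp
      next
        case False
        then have x: "0 < f x" "0 < w x" using elim assms(4)[of x] by auto
        have "(l * (f x powr p * w x)) powr \<theta> * ((l * w x) powr (- \<kappa>)) powr (1 - \<theta>)
            \<le> \<theta> * (l * (f x powr p * w x)) + (1 - \<theta>) * (l * w x) powr (- \<kappa>)"
          using \<theta> l x by (intro Youngs_inequality_0) auto
        moreover have "(l * (f x powr p * w x)) powr \<theta> * ((l * w x) powr (- \<kappa>)) powr (1 - \<theta>)
            = f x powr q"
        proof -
          have "(l * (f x powr p * w x)) powr \<theta> = (f x powr p * (l * w x)) powr \<theta>"
            by (simp add: mult_ac)
          also have "\<dots> = f x powr q * (l * w x) powr \<theta>"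
            using l x \<theta>(4) by (subst powr_mult) (auto simp: powr_powr)
          finally have 1: "(l * (f x powr p * w x)) powr \<theta> = f x powr q * (l * w x) powr \<theta>" .
          have 2: "((l * w x) powr (- \<kappa>)) powr (1 - \<theta>) = (l * w x) powr (- \<theta>)"
            by (simp only: powr_powr mult_minus_left \<theta>(3))
          show ?thesis
            unfolding 1 2 mult.assoc powr_add[symmetric] using l x by simp
        qed
        ultimately show ?thesis using l x by (simp add: powr_mult mult_ac)
      qed
    qed
    have "(\<integral>x. f x powr q \<partial>M) \<le> (\<integral>x. ?b x \<partial>M)"
    proof (rule integral_mono_AE'[OF int_b Young])
      show "AE x in M. 0 \<le> ?b x"
        using Young by eventually_elim (rule order_trans[OF powr_ge_zero])
    qed
    also have "\<dots> = (\<theta> * l) * (\<integral>x. f x powr p * w x \<partial>M) + ((1 - \<theta>) * l powr (- \<kappa>)) * (\<integral>x. w x powr (- \<kappa>) \<partial>M)"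
      using int by simp
    also have "\<dots> \<le> (\<theta> * l) * J + ((1 - \<theta>) * l powr (- \<kappa>)) * L"
      using \<theta> l J L by (intro add_mono mult_left_mono) auto
    also have "\<dots> = \<theta> * (l * J) + (1 - \<theta>) * (l powr (- \<kappa>) * L)" by simp
    also have "\<dots> = J powr \<theta> * L powr (1 - \<theta>)"
    proof -
      have 1: "l * J = J powr \<theta> * L powr (1 - \<theta>)"
        using J L by (simp add: l_def powr_divide powr_diff)
      have "l powr (- \<kappa>) = (L / J) powr (- \<theta>)"
        using \<theta>(3) by (simp add: l_def powr_powr mult.commute)
      also have "\<dots> = J powr \<theta> * L powr (- \<theta>)"
        using J L by (simp add: powr_divide powr_minus field_simps)
      finally have "l powr (- \<kappa>) * L = J powr \<theta> * (L powr 1 * L powr (- \<theta>))"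
        using L by simp
      then have 2: "l powr (- \<kappa>) * L = J powr \<theta> * L powr (1 - \<theta>)"
        unfolding powr_add[symmetric] by simp
      show ?thesis unfolding 1 2 by (simp add: algebra_simps)
    qed
    finally show ?thesis .
  qed
  have A0: "0 \<le> ?A"
  proof (rule integral_nonneg_AE)
    show "AE x in M. 0 \<le> f x powr p * w x"
      using assms(5) by eventually_elim (use p in \<open>auto simp: less_imp_le\<close>)
  qed
  have B0: "0 \<le> ?B" by simp
  have "((\<lambda>e. (?A + e) powr \<theta> * (?B + e) powr (1 - \<theta>)) \<longlongrightarrow> (?A + 0) powr \<theta> * (?B + 0) powr (1 - \<theta>))
      (at_right 0)"
    using \<theta> A0 B0
    by (intro tendsto_mult tendsto_powr' tendsto_add tendsto_const tendsto_ident_at)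
      (auto simp: eventually_at_filter intro!: always_eventually)
  moreover have "eventually (\<lambda>e. (\<integral>x. f x powr q \<partial>M) \<le> (?A + e) powr \<theta> * (?B + e) powr (1 - \<theta>)) (at_right 0)"
    using A0 B0 by (auto simp: eventually_at_filter intro!: always_eventually perturbed add_nonneg_pos)
  ultimately have "(\<integral>x. f x powr q \<partial>M) \<le> (?A + 0) powr \<theta> * (?B + 0) powr (1 - \<theta>)"
    by (rule tendsto_lowerbound) simp
  then show ?thesis by (simp add: \<theta>_def)
qed

text \<open>
  On each dyadic shell about the origin the integrand is comparable to its value on the inner sphere, so it
  is dominated by a series of multiples of indicator functions of balls, whose integrals form a geometric
  series.
\<close>

lemma nn_integral_norm_powr_ball:
  fixes a \<rho> :: real
  assumes "0 < a" "a < DIM('a::euclidean_space)" "0 < \<rho>"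
  shows "(\<integral>\<^sup>+x\<in>ball (0::'a) \<rho>. ennreal ((norm x / \<rho>) powr (- a)) \<partial>lborel)
    \<le> ennreal (unit_ball_vol (DIM('a)) * 2 powr a / (1 - 2 powr (a - DIM('a))) * \<rho> ^ DIM('a))"
proof -
  let ?n = "DIM('a)"
  let ?V = "unit_ball_vol (real ?n)"
  define B where "B k = ball (0::'a) (\<rho> * (1/2) ^ k)" for k
  define c where "c k = 2 powr (a * (real k + 1))" for k
  have [measurable]: "B k \<in> sets borel" for k by (simp add: B_def)
  have c0: "0 \<le> c k" for k by (simp add: c_def)
  have "(\<integral>\<^sup>+x\<in>ball (0::'a) \<rho>. ennreal ((norm x / \<rho>) powr (- a)) \<partial>lborel)
      \<le> (\<integral>\<^sup>+x. (\<Sum>k. ennreal (c k) * indicator (B k) x) \<partial>lborel)"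
  proof (rule nn_integral_mono)
    fix x :: 'a
    show "ennreal ((norm x / \<rho>) powr (- a)) * indicator (ball 0 \<rho>) x
        \<le> (\<Sum>k. ennreal (c k) * indicator (B k) x)"
    proof (cases "x \<in> ball 0 \<rho> \<and> x \<noteq> 0")
      case True
      then have x: "0 < norm x / \<rho>" "norm x / \<rho> < 1" using assms by auto
      obtain m where m: "(1/2) ^ m < norm x / \<rho>"
        using real_arch_pow_inv[OF x(1), of "1/2"] by auto
      define k where "k = (LEAST m. (1/2) ^ Suc m \<le> norm x / \<rho>)"
      have ex: "(1/2) ^ Suc m \<le> norm x / \<rho>"
        using m x(1) by (smt (verit) power_Suc zero_less_power field_sum_of_halves mult_le_cancel_right1 half_gt_zero)
      have k: "(1/2) ^ Suc k \<le> norm x / \<rho>" unfolding k_def using ex by (rule LeastI)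
      have "norm x / \<rho> < (1/2) ^ k"
      proof (cases k)
        case 0
        then show ?thesis using x by simp
      next
        case (Suc j)
        then have "\<not> (1/2) ^ Suc j \<le> norm x / \<rho>"
          using not_less_Least[of j "\<lambda>m. (1/2) ^ Suc m \<le> norm x / \<rho>"] k_def by simp
        then show ?thesis using Suc by simp
      qed
      then have xB: "x \<in> B k" using assms by (simp add: B_def field_simps)
      have "(norm x / \<rho>) powr (- a) \<le> ((1/2) ^ Suc k) powr (- a)"
        using k assms by (intro powr_mono2') auto
      also have "\<dots> = c k"
      proof -
        have "(1/2::real) ^ Suc k = 2 powr (- real (Suc k))"
          by (subst powr_minus, subst powr_realpow) (auto simp: power_one_over inverse_eq_divide simp del: power_Suc)
        then show ?thesis unfolding c_def by (simp only: powr_powr) (simp add: algebra_simps)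
      qed
      finally have "ennreal ((norm x / \<rho>) powr (- a)) \<le> ennreal (c k) * indicator (B k) x"
        using xB by (simp add: ennreal_leI)
      also have "\<dots> \<le> (\<Sum>k. ennreal (c k) * indicator (B k) x)"
      proof -
        have "F k \<le> suminf F" for F :: "nat \<Rightarrow> ennreal"
          using sum_le_suminf[OF summableI, of "{k}" F] by simp
        then show ?thesis .
      qed
      finally show ?thesis using True by simp
    qed auto
  qed
  also have "\<dots> = (\<Sum>k. ennreal (c k) * emeasure lborel (B k))"
    by (subst nn_integral_suminf) (auto simp: nn_integral_cmult)
  also have "\<dots> = (\<Sum>k. ennreal (?V * 2 powr a * \<rho> ^ ?n * (2 powr (a - ?n)) ^ k))"
  proof (rule suminf_cong)
    fix k
    have "emeasure lborel (B k) = ennreal (?V * (\<rho> * (1/2) ^ k) ^ ?n)"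
      unfolding B_def using assms by (intro emeasure_ball) auto
    then have "ennreal (c k) * emeasure lborel (B k) = ennreal (c k * (?V * (\<rho> * (1/2) ^ k) ^ ?n))"
      by (simp only: ennreal_mult'[OF c0])
    also have "c k * (?V * (\<rho> * (1/2) ^ k) ^ ?n) = ?V * 2 powr a * \<rho> ^ ?n * (2 powr (a - ?n)) ^ k"
    proof -
      have "c k = 2 powr a * (2 powr a) ^ k"
        by (simp add: c_def powr_add ring_distribs powr_power mult.commute)
      moreover have "((1/2) ^ k) ^ ?n = (1 / 2 powr ?n) ^ k"
        by (simp add: powr_realpow power_one_over mult.commute flip: power_mult)
      moreover have "(2 powr (a - ?n)) ^ k = (2 powr a) ^ k * (1 / 2 powr ?n) ^ k"
        by (simp add: powr_diff power_divide)
      ultimately show ?thesis by (simp add: power_mult_distrib)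
    qed
    finally show "ennreal (c k) * emeasure lborel (B k)
        = ennreal (?V * 2 powr a * \<rho> ^ ?n * (2 powr (a - ?n)) ^ k)" .
  qed
  also have "\<dots> = ennreal (?V * 2 powr a * \<rho> ^ ?n * (1 / (1 - 2 powr (a - ?n))))"
  proof (rule suminf_ennreal_eq)
    have "2 powr (a - ?n) < (1::real)" using assms powr_less_mono[of "a - ?n" 0 2] by simp
    then show "(\<lambda>k. ?V * 2 powr a * \<rho> ^ ?n * (2 powr (a - ?n)) ^ k)
        sums (?V * 2 powr a * \<rho> ^ ?n * (1 / (1 - 2 powr (a - ?n))))"
      by (intro sums_mult geometric_sums) auto
  qed (use assms in auto)
  finally show ?thesis by (simp add: field_simps)
qed

text \<open>
  The constant depends neither on the centre nor on the radius. A ball that is far from the origin compared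
  with its radius only meets points of norm comparable to \<open>norm z + r\<close>; any other ball lies in
  the ball of radius \<open>3 * r\<close> about the origin.
\<close>

lemma integral_norm_powr_ball:
  fixes a :: real
  assumes a: "0 < a" "a < DIM('a::euclidean_space)"
  obtains C where "0 < C"
    "\<And>(z::'a) r. 0 < r \<Longrightarrow> integrable lborel (\<lambda>x. indicator (ball z r) x * (norm x / (norm z + r)) powr (- a))"
    "\<And>(z::'a) r. 0 < r \<Longrightarrow> (\<integral>x. indicator (ball z r) x * (norm x / (norm z + r)) powr (- a) \<partial>lborel) \<le> C * r ^ DIM('a)"
proof -
  let ?n = "DIM('a)"
  let ?V = "unit_ball_vol (real ?n)"
  define C0 where "C0 = ?V * 2 powr a / (1 - 2 powr (a - ?n))"
  have "2 powr (a - ?n) < (1::real)" using assms powr_less_mono[of "a - ?n" 0 2] by simp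
  then have C0: "0 < C0" using a by (simp add: C0_def)
  define C where "C = 3 powr a * ?V + C0 * 3 ^ ?n"
  have C: "0 < C" using C0 by (simp add: C_def add_nonneg_pos)
  let ?f = "\<lambda>(z::'a) r x. indicator (ball z r) x * (norm x / (norm z + r)) powr (- a)"
  have bound: "(\<integral>\<^sup>+x. ennreal (?f z r x) \<partial>lborel) \<le> ennreal (C * r ^ ?n)" if r: "0 < r" for z r
  proof -
    let ?g = "\<lambda>x::'a. ennreal (3 powr a) * indicator (ball z r) x"
    let ?h = "\<lambda>x::'a. ennreal ((norm x / (3 * r)) powr (- a)) * indicator (ball 0 (3 * r)) x"
    have pw: "ennreal (?f z r x) \<le> ?g x + ?h x" for x
    proof (cases "x \<in> ball z r \<and> x \<noteq> 0")
      case True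
      then have x: "norm x > 0" "norm (z - x) < r" by (auto simp: dist_norm)
      show ?thesis
      proof (cases "2 * r \<le> norm z")
        case far: True
        have "norm z - norm x < r" using x norm_triangle_ineq2[of z x] by linarith
        then have "norm z + r \<le> 3 * norm x" using far by linarith
        then have "1 / 3 \<le> norm x / (norm z + r)" using r by (simp add: field_simps add_pos_nonneg)
        then have "(norm x / (norm z + r)) powr (- a) \<le> (1 / 3) powr (- a)"
          using a by (intro powr_mono2') auto
        then have "ennreal (?f z r x) \<le> ?g x"
          using True by (simp add: ennreal_leI powr_minus powr_divide)
        then show ?thesis by (rule order_trans) simp
      next
        case near: False
        have "norm x < 3 * r" using x near norm_triangle_ineq2[of x z] by (simp add: norm_minus_commute)
        moreover have "norm x / (3 * r) \<le> norm x / (norm z + r)"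
          using near r by (intro divide_left_mono mult_pos_pos) (auto intro: add_nonneg_pos)
        then have "(norm x / (norm z + r)) powr (- a) \<le> (norm x / (3 * r)) powr (- a)"
          using a x r by (intro powr_mono2') auto
        ultimately have "ennreal (?f z r x) \<le> ?h x"
          using True by (simp add: ennreal_leI)
        then show ?thesis by (rule order_trans) simp
      qed
    qed auto
    have "(\<integral>\<^sup>+x. ennreal (?f z r x) \<partial>lborel) \<le> (\<integral>\<^sup>+x. ?g x + ?h x \<partial>lborel)"
      by (intro nn_integral_mono pw)
    also have "\<dots> = ennreal (3 powr a) * emeasure lborel (ball z r) + (\<integral>\<^sup>+x. ?h x \<partial>lborel)"
    proof (subst nn_integral_add)
      show "?g \<in> borel_measurable lborel"
        by (intro borel_measurable_times_ennreal borel_measurable_const borel_measurable_indicator) simp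
      show "?h \<in> borel_measurable lborel"
        by (intro borel_measurable_times_ennreal borel_measurable_indicator measurable_compose[OF _ measurable_ennreal]
            powr_real_measurable borel_measurable_divide borel_measurable_norm borel_measurable_const) simp_all
      show "(\<integral>\<^sup>+x. ?g x \<partial>lborel) + (\<integral>\<^sup>+x. ?h x \<partial>lborel)
          = ennreal (3 powr a) * emeasure lborel (ball z r) + (\<integral>\<^sup>+x. ?h x \<partial>lborel)"
        by (subst nn_integral_cmult_indicator) simp_all
    qed
    also have "\<dots> \<le> ennreal (3 powr a * (?V * r ^ ?n)) + ennreal (C0 * (3 * r) ^ ?n)"
    proof (rule add_mono)
      have "emeasure lborel (ball z r) = ennreal (?V * r ^ ?n)"
        using r by (intro emeasure_ball) auto
      then show "ennreal (3 powr a) * emeasure lborel (ball z r) \<le> ennreal (3 powr a * (?V * r ^ ?n))"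
        by (simp only: ennreal_mult'[OF powr_ge_zero] order_refl)
      show "(\<integral>\<^sup>+x. ?h x \<partial>lborel) \<le> ennreal (C0 * (3 * r) ^ ?n)"
        unfolding C0_def using r by (intro nn_integral_norm_powr_ball a) auto
    qed
    also have "\<dots> = ennreal (3 powr a * (?V * r ^ ?n) + C0 * (3 * r) ^ ?n)"
      using r C0 by (intro ennreal_plus[symmetric]) auto
    also have "3 powr a * (?V * r ^ ?n) + C0 * (3 * r) ^ ?n = C * r ^ ?n"
      by (simp add: C_def power_mult_distrib algebra_simps)
    finally show ?thesis .
  qed
  have m: "?f z r \<in> borel_measurable lborel" for z r
    by (intro borel_measurable_times borel_measurable_indicator powr_real_measurable borel_measurable_divide
        borel_measurable_norm borel_measurable_const) simp_all
  show ?thesis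
  proof (rule that[OF C])
    fix z :: 'a and r :: real
    assume r: "0 < r"
    show "integrable lborel (?f z r)"
      using le_less_trans[OF bound[OF r, of z] ennreal_less_top]
      by (intro integrableI_bounded m) (simp add: abs_mult)
    show "(\<integral>x. ?f z r x \<partial>lborel) \<le> C * r ^ ?n"
      using bound[OF r, of z] C r m
      by (subst integral_eq_nn_integral) (auto intro!: enn2real_leI)
  qed
qed

text \<open>
  The bookkeeping of powers when the average over a ball of measure \<open>V * T\<close> is taken: with
  \<open>T = r ^ n\<close>, all powers of \<open>T\<close> and \<open>s\<close> cancel.
\<close>

lemma scaling_exponents:
  fixes p q I A s T V C c H :: real
  assumes q: "0 < q" "q < p" and nn: "0 \<le> A" "0 \<le> I"
    and pos: "0 < s" "0 < T" "0 < V" "0 < C" "0 < c" "0 < H"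
    and le: "A \<le> (I / H powr p) powr (q / p) * ((s / c) powr (q / (p - q)) * (C * T)) powr (1 - q / p)"
  shows "T powr (1 / p) * (1 / s) powr (1 / p) * (A / (V * T)) powr (1 / q)
    \<le> (1 / c) powr (1 / p) * C powr (1 / q - 1 / p) * (1 / V) powr (1 / q) / H * I powr (1 / p)"
proof -
  have ex: "q / p * (1 / q) = 1 / p" "q / (p - q) * (1 / q - 1 / p) = 1 / p"
    "(1 - q / p) * (1 / q) = 1 / q - 1 / p" "p * (1 / p) = 1"
    "q * (1 / q - 1 / p) / (p - q) = 1 / p"
    using q by (auto simp: field_simps)
  have "A powr (1 / q) \<le> ((I / H powr p) powr (q / p) * ((s / c) powr (q / (p - q)) * (C * T)) powr (1 - q / p)) powr (1 / q)"
    using q nn le by (intro powr_mono2) auto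
  also have "\<dots> = (I / H powr p) powr (1 / p) * ((s / c) powr (q / (p - q)) * (C * T)) powr (1 / q - 1 / p)"
    by (simp only: powr_powr powr_mult mult.assoc ex)
  also have "\<dots> = (I powr (1 / p) / H) * ((s / c) powr (1 / p) * (C powr (1 / q - 1 / p) * T powr (1 / q - 1 / p)))"
    using nn pos q by (simp add: powr_powr powr_mult powr_divide ex)
  finally have "T powr (1 / p) * (1 / s) powr (1 / p) * (A powr (1 / q) * (1 / (V * T)) powr (1 / q))
      \<le> T powr (1 / p) * (1 / s) powr (1 / p) *
        ((I powr (1 / p) / H) * ((s / c) powr (1 / p) * (C powr (1 / q - 1 / p) * T powr (1 / q - 1 / p))) * (1 / (V * T)) powr (1 / q))"
    by (intro mult_left_mono mult_right_mono) auto
  also have "\<dots> = (1 / c) powr (1 / p) * C powr (1 / q - 1 / p) * (1 / V) powr (1 / q) / H * I powr (1 / p)"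
    using pos by (simp add: powr_divide powr_mult powr_diff mult_ac)
  also have "A powr (1 / q) * (1 / (V * T)) powr (1 / q) = (A / (V * T)) powr (1 / q)"
    using nn pos by (simp add: powr_divide)
  finally show ?thesis .
qed

section \<open>Test functions and the averaged estimate\<close>

text \<open>
  All derivatives of a test function vanish off its support, where it is locally zero; hence continuity on
  \<open>U\<close>, which is all that smoothness on \<open>U\<close> provides, becomes continuity
  everywhere.
\<close>

lemma test_function_regularity:
  fixes u :: "real ^ 'n::finite \<Rightarrow> real"
  assumes "open U" and u: "u \<in> test_functions U"
  shows "(u has_derivative (\<lambda>v. gradient u x \<bullet> v)) (at x)"
    and "continuous_on UNIV (gradient u)"
    and "compact (support u)" and "support u \<subseteq> U"
    and "\<And>x. x \<notin> support u \<Longrightarrow> u x = 0"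
    and "\<And>x. x \<notin> support u \<Longrightarrow> gradient u x = 0"
proof -
  show K: "compact (support u)" "support u \<subseteq> U" using u by (auto simp: test_functions_def)
  show u0: "u x = 0" if "x \<notin> support u" for x
    using that closure_subset[of "{x. u x \<noteq> 0}"] unfolding support_def by blast
  have "C_k 1 U u" using u by (simp add: test_functions_def smooth_on_def)
  then have diff: "\<And>x. x \<in> U \<Longrightarrow> u differentiable (at x)"
    and cont: "\<And>v. continuous_on U (\<lambda>x. frechet_derivative u (at x) v)"
    by auto
  have open_off: "open (- support u)" by (simp add: support_def open_Compl)
  have off: "(u has_derivative (\<lambda>_. 0)) (at x)" if "x \<notin> support u" for x
    using open_off that u0
    by (intro has_derivative_transform_within_open[of "\<lambda>_. 0" _ x UNIV "- support u" u]) auto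
  have der: "(u has_derivative frechet_derivative u (at x)) (at x)" for x
    using diff[of x] off[of x] K(2) frechet_derivative_works[of u "at x"] differentiableI[of u _ "at x"]
    by (cases "x \<in> support u") auto
  have inner: "frechet_derivative u (at x) v = gradient u x \<bullet> v" for x v
  proof -
    have lin: "linear (frechet_derivative u (at x))"
      using der by (rule has_derivative_linear)
    have "frechet_derivative u (at x) v = frechet_derivative u (at x) (\<Sum>i\<in>UNIV. v $ i *\<^sub>R axis i 1)"
      using basis_expansion[of v] by (simp add: scalar_mult_eq_scaleR)
    then show ?thesis
      using lin by (simp add: linear_sum linear_cmul gradient_def inner_vec_def mult.commute)
  qed
  show "(u has_derivative (\<lambda>v. gradient u x \<bullet> v)) (at x)" for x
    using der[of x] by (simp add: inner[abs_def])
  have zero: "frechet_derivative u (at x) v = 0" if "x \<notin> support u" for x v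
    using has_derivative_unique[OF der off[OF that]] by (rule fun_cong)
  show "gradient u x = 0" if "x \<notin> support u" for x
    using zero[OF that] by (simp add: gradient_def vec_eq_iff)
  show "continuous_on UNIV (gradient u)"
    unfolding gradient_def[abs_def]
    by (intro continuous_on_vec_lambda continuous_on_extend_by_zero[OF \<open>open U\<close> compact_imp_closed[OF K(1)] K(2)] cont zero)
qed

lemma set_lebesgue_integral_of_support:
  fixes f :: "'a::euclidean_space \<Rightarrow> real"
  assumes "continuous_on UNIV f" "\<And>x. x \<notin> S \<Longrightarrow> f x = 0"
  shows "(LINT x:S|lebesgue. f x) = (\<integral>x. f x \<partial>lborel)"
proof -
  have "(\<lambda>x. indicator S x *\<^sub>R f x) = f" using assms(2) by (auto simp: fun_eq_iff indicator_def)
  moreover have "f \<in> borel_measurable lborel"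
    using assms(1) by (simp add: borel_measurable_continuous_onI)
  ultimately show ?thesis by (simp add: set_lebesgue_integral_def integral_completion)
qed

theorem theoremC:
  fixes p q :: real
  assumes "CARD('n::finite) \<ge> 2" and "p > real CARD('n)" and "1 \<le> q" and "q < p"
  shows "\<exists>\<Theta> C :: real. \<Theta> \<ge> 0 \<and> C > 0 \<and>
    (\<forall>(\<Omega> :: (real ^ 'n) set) u z r D.
       open \<Omega> \<longrightarrow> connected \<Omega> \<longrightarrow> bounded \<Omega> \<longrightarrow> 0 \<in> \<Omega> \<longrightarrow>
       u \<in> test_functions (\<Omega> - {0}) \<longrightarrow>
       0 < r \<longrightarrow> r < diameter \<Omega> \<longrightarrow> D \<ge> exp \<Theta> * diameter \<Omega> \<longrightarrow>
       hardy_difference p \<Omega> u \<ge> 0 \<and>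
       r powr (real CARD('n) / p) * X (r / D) powr (1 / p) *
         (1 / measure lebesgue (ball z r) *
           (LINT x:ball z r|lebesgue. \<bar>u x\<bar> powr q / norm x powr q)) powr (1 / q)
       \<le> C * hardy_difference p \<Omega> u powr (1 / p))"
proof -
  let ?n = "CARD('n)"
  let ?V = "unit_ball_vol (real ?n)"
  define H where "H = (p - ?n) / p"
  define \<kappa> where "\<kappa> = q / (p - q)"
  \<comment> \<open>Half of the critical exponent \<open>n\<close> is used up: \<open>2 * \<beta> * \<kappa> = n / 2\<close>, so that the negative power of
    the weight in Hoelder's inequality is locally integrable.\<close>
  define \<beta> where "\<beta> = ?n * (p - q) / (4 * q)"
  define B where "B = H + 2 + 2 * H / \<beta>"
  define c where "c = \<beta> / (4 * H * B\<^sup>2)"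
  have pq: "0 < q" "0 < p" "p \<ge> 2" "p > DIM(real ^ 'n)" "0 < p - q" using assms by auto
  have H: "0 < H" using assms pq by (simp add: H_def)
  have \<beta>: "0 < \<beta>" using assms pq by (simp add: \<beta>_def)
  have "2 * (?n * d / (4 * q)) * (q / d) = ?n / 2" if "0 < d" for d :: real using that pq by simp
  from this[OF pq(5)] have \<kappa>: "0 < \<kappa>" "2 * \<beta> * \<kappa> = ?n / 2" using pq by (auto simp: \<kappa>_def \<beta>_def)
  have "0 < B" using H \<beta> by (simp add: B_def add_pos_pos)
  then have c: "0 < c" using H \<beta> by (simp add: c_def)
  have V: "0 < ?V" by simp
  have n2: "0 < real ?n / 2" "real ?n / 2 < DIM(real ^ 'n)" using assms by auto
  have dim: "DIM(real ^ 'n) = ?n" by simp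
  obtain C0 where C0: "0 < C0"
    and int_C0: "\<And>(z::real ^ 'n) r. 0 < r \<Longrightarrow>
      integrable lborel (\<lambda>x. indicator (ball z r) x * (norm x / (norm z + r)) powr (- (?n / 2)))"
    and le_C0: "\<And>(z::real ^ 'n) r. 0 < r \<Longrightarrow>
      (\<integral>x. indicator (ball z r) x * (norm x / (norm z + r)) powr (- (?n / 2)) \<partial>lborel) \<le> C0 * r ^ ?n"
    by (rule integral_norm_powr_ball[OF n2, unfolded dim]) (rule that; blast)
  define C where "C = (1 / c) powr (1 / p) * C0 powr (1 / q - 1 / p) * (1 / ?V) powr (1 / q) / H"
  have "0 < C" using c C0 less_imp_neq[OF V] H by (simp add: C_def)
  have main: "hardy_difference p \<Omega> u \<ge> 0 \<and>
       r powr (real ?n / p) * X (r / D) powr (1 / p) *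
         (1 / measure lebesgue (ball z r) *
           (LINT x:ball z r|lebesgue. \<bar>u x\<bar> powr q / norm x powr q)) powr (1 / q)
       \<le> C * hardy_difference p \<Omega> u powr (1 / p)"
    if \<Omega>: "open \<Omega>" "bounded \<Omega>" "0 \<in> \<Omega>" and u: "u \<in> test_functions (\<Omega> - {0})"
      and r: "0 < r" "r < diameter \<Omega>" and D: "D \<ge> diameter \<Omega>"
    for \<Omega> :: "(real ^ 'n) set" and u z r D
  proof -
    define K where "K = support u"
    \<comment> \<open>the smallest ball about the origin that contains \<open>ball z r\<close> has radius \<open>R\<close>\<close>
    define R where "R = norm z + r"
    \<comment> \<open>\<open>s\<close> is the reciprocal of \<open>X (r / D)\<close>\<close>
    define s where "s = 1 + ln (D / r)"
    define I where "I = hardy_difference p \<Omega> u"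
    have pos: "0 < D" "r \<le> D" "0 < R" "r \<le> R" using r D by (auto simp: R_def add_nonneg_pos)
    have s: "1 \<le> s" using r pos by (simp add: s_def)
    have "open (\<Omega> - {0})" using \<Omega> by (simp add: open_delete)
    note reg = test_function_regularity[OF this u, folded K_def]
    have K: "0 < norm x \<and> norm x \<le> D" if "x \<in> K" for x
    proof -
      have "x \<in> \<Omega>" "x \<noteq> 0" using that reg(4) by auto
      moreover have "dist 0 x \<le> diameter \<Omega>"
        using \<Omega> \<open>x \<in> \<Omega>\<close> by (intro diameter_bounded_bound) auto
      ultimately show ?thesis using D by simp
    qed
    have contu: "continuous_on UNIV u"
      using reg(1) by (intro continuous_at_imp_continuous_on ballI has_derivative_continuous) blast
    have cont_quot: "continuous_on UNIV (\<lambda>x. \<bar>u x\<bar> powr e / norm x powr e)" if "0 < e" for e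
    proof (rule continuous_on_extend_by_zero[where U = "- {0}" and K = K])
      show "continuous_on (- {0}) (\<lambda>x. \<bar>u x\<bar> powr e / norm x powr e)"
        using that by (intro continuous_on_powr' continuous_intros continuous_on_subset[OF contu]) auto
    qed (use reg K in \<open>auto simp: compact_imp_closed\<close>)
    define F where "F x = \<bar>u x\<bar> powr p / norm x powr p" for x
    define h where "h \<rho> = s * \<beta> * (\<rho> / R) powr \<beta> / (1 + (\<rho> / R) powr \<beta>)\<^sup>2
                / (H * (H * (1 + ln (D / \<rho>)) + 1 + s / (1 + (\<rho> / R) powr \<beta>))\<^sup>2)" for \<rho>
    have "0 \<le> s" using s by simp
    note hardy = improved_Hardy_inequality[OF pq(4,3) reg(1,2,3,5) K pos(1,3) this \<beta>]
    have int_Fh1: "integrable lborel (\<lambda>x. F x * (1 + h (norm x)))"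
      and hardy': "H powr p * (\<integral>x. F x * (1 + h (norm x)) \<partial>lborel) \<le> (\<integral>x. norm (gradient u x) powr p \<partial>lborel)"
      using hardy by (simp_all add: F_def h_def H_def)
    have int_F: "integrable lborel F"
      unfolding F_def by (rule integrable_compact_support[OF reg(3)])
        (use cont_quot[of p] pq reg in auto)
    have int_Fh: "integrable lborel (\<lambda>x. F x * h (norm x))"
      using Bochner_Integration.integrable_diff[OF int_Fh1 int_F] by (simp add: algebra_simps)
    have "(\<integral>x. F x * (1 + h (norm x)) \<partial>lborel) = (\<integral>x. F x \<partial>lborel) + (\<integral>x. F x * h (norm x) \<partial>lborel)"
      using Bochner_Integration.integral_add[OF int_F int_Fh] by (simp add: distrib_left)
    moreover have "I = (\<integral>x. norm (gradient u x) powr p \<partial>lborel) - H powr p * (\<integral>x. F x \<partial>lborel)"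
    proof -
      have "(LINT x:\<Omega>|lebesgue. norm (gradient u x) powr p) = (\<integral>x. norm (gradient u x) powr p \<partial>lborel)"
      proof (rule set_lebesgue_integral_of_support)
        show "continuous_on UNIV (\<lambda>x. norm (gradient u x) powr p)"
          using pq reg(2) by (intro continuous_on_powr' continuous_intros) auto
      qed (use reg in auto)
      moreover have "(LINT x:\<Omega>|lebesgue. F x) = (\<integral>x. F x \<partial>lborel)"
        unfolding F_def by (rule set_lebesgue_integral_of_support) (use cont_quot pq reg in auto)
      ultimately show ?thesis unfolding I_def hardy_difference_def H_def F_def by simp
    qed
    ultimately have I: "H powr p * (\<integral>x. F x * h (norm x) \<partial>lborel) \<le> I"
      using hardy' by (simp add: distrib_left)
    \<comment> \<open>a lower bound for the surplus weight on the ball, and zero outside\<close>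
    define w where "w x = indicator (ball z r) x * (c / s * (norm x / R) powr (2 * \<beta>))" for x
    define f where "f x = indicator (ball z r) x * (\<bar>u x\<bar> / norm x)" for x
    have [measurable]: "u \<in> borel_measurable borel" using contu by (rule borel_measurable_continuous_onI)
    have [measurable]: "ball z r \<in> sets borel" by simp
    have mf: "f \<in> borel_measurable lborel" unfolding f_def
      by (intro borel_measurable_times borel_measurable_indicator borel_measurable_divide borel_measurable_abs
        borel_measurable_norm) simp_all
    have mw: "w \<in> borel_measurable lborel" unfolding w_def
      by (intro borel_measurable_times borel_measurable_indicator powr_real_measurable borel_measurable_divide
        borel_measurable_norm borel_measurable_const) simp_all
    have h0: "0 \<le> h \<rho>" for \<rho> using s \<beta> H by (simp add: h_def)
    have fw: "0 \<le> f x powr p * w x" "f x powr p * w x \<le> F x * h (norm x)" for x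
    proof -
      show "0 \<le> f x powr p * w x" using c s by (simp add: w_def)
      show "f x powr p * w x \<le> F x * h (norm x)"
      proof (cases "x \<in> ball z r \<and> x \<in> K")
        case True
        then have "norm x \<le> R" using norm_triangle_ineq2[of x z] by (simp add: R_def dist_norm norm_minus_commute)
        then have "w x \<le> h (norm x)"
          using True K[of x] logarithmic_weight_lower_bound[of H \<beta> "norm x" R r D] H \<beta> r pos
          by (simp add: w_def h_def c_def B_def s_def)
        moreover have "f x powr p = F x" using True by (simp add: f_def F_def powr_divide)
        moreover have "0 \<le> F x" by (simp add: F_def)
        ultimately show ?thesis by (simp only: mult_left_mono)
      next
        case False
        then have "f x = 0" using reg(5)[of x] by (auto simp: f_def)
        then show ?thesis using h0 by (simp add: F_def)
      qed
    qed
    have int_fw: "integrable lborel (\<lambda>x. f x powr p * w x)"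
    proof (rule Bochner_Integration.integrable_bound[OF int_Fh])
      show "(\<lambda>x. f x powr p * w x) \<in> borel_measurable lborel"
        using mf mw by (intro borel_measurable_times powr_real_measurable) auto
      show "AE x in lborel. norm (f x powr p * w x) \<le> norm (F x * h (norm x))"
      proof (rule AE_I2)
        fix x
        show "norm (f x powr p * w x) \<le> norm (F x * h (norm x))"
          using fw[of x] unfolding real_norm_def by linarith
      qed
    qed
    have w_kappa: "w x powr (- \<kappa>)
        = (s / c) powr \<kappa> * (indicator (ball z r) x * (norm x / R) powr (- (?n / 2)))" for x
    proof (cases "x \<in> ball z r")
      case True
      have "w x powr (- \<kappa>) = (c / s) powr (- \<kappa>) * (norm x / R) powr (- (2 * \<beta> * \<kappa>))"
      proof -
        have "w x = c / s * (norm x / R) powr (2 * \<beta>)" using True by (simp add: w_def)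
        then show ?thesis by (simp only: powr_mult powr_powr mult_minus_right)
      qed
      moreover have "(c / s) powr (- \<kappa>) = (s / c) powr \<kappa>"
        using c s by (simp add: powr_minus powr_divide)
      ultimately show ?thesis using True by (simp add: \<kappa>(2))
    qed (simp add: w_def)
    have int_w: "integrable lborel (\<lambda>x. w x powr (- \<kappa>))"
      unfolding w_kappa R_def using int_C0[OF r(1)] by (rule integrable_mult_right)
    have le_w: "(\<integral>x. w x powr (- \<kappa>) \<partial>lborel) \<le> (s / c) powr \<kappa> * (C0 * r ^ ?n)"
      unfolding w_kappa R_def integral_mult_right_zero
      using le_C0[OF r(1)] by (rule mult_left_mono) simp
    have "(\<integral>x. f x powr p * w x \<partial>lborel) \<le> (\<integral>x. F x * h (norm x) \<partial>lborel)"
      using fw(2) by (intro integral_mono int_fw int_Fh)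
    also have "\<dots> \<le> I / H powr p" using I H by (simp add: field_simps)
    finally have le_fw: "(\<integral>x. f x powr p * w x \<partial>lborel) \<le> I / H powr p" .
    have fw0: "0 \<le> (\<integral>x. f x powr p * w x \<partial>lborel)" using fw(1) by simp
    then have "0 \<le> I / H powr p" using le_fw by simp
    then have I0: "0 \<le> I" using H by (simp add: zero_le_divide_iff)
    have f0: "0 \<le> f x" for x by (simp add: f_def)
    have fw_pos: "f x \<noteq> 0 \<longrightarrow> 0 < w x" for x
      using c s pos by (auto simp: f_def w_def indicator_def split: if_splits)
    let ?A = "\<integral>x. f x powr q \<partial>lborel"
    have "?A \<le> (\<integral>x. f x powr p * w x \<partial>lborel) powr (q / p) * (\<integral>x. w x powr (- \<kappa>) \<partial>lborel) powr (1 - q / p)"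
      unfolding \<kappa>_def
      by (rule Hoelder_weighted) (use pq assms(4) f0 fw_pos mf int_fw int_w in \<open>auto simp: \<kappa>_def\<close>)
    also have "\<dots> \<le> (I / H powr p) powr (q / p) * ((s / c) powr \<kappa> * (C0 * r ^ ?n)) powr (1 - q / p)"
      using pq assms(4) le_fw fw0 le_w by (intro mult_mono powr_mono2) auto
    finally have A: "?A \<le> (I / H powr p) powr (q / p) * ((s / c) powr (q / (p - q)) * (C0 * r ^ ?n)) powr (1 - q / p)"
      by (simp add: \<kappa>_def)
    have "0 \<le> ?A" by simp
    have fin: "(r ^ ?n) powr (1 / p) * (1 / s) powr (1 / p) * (?A / (?V * r ^ ?n)) powr (1 / q) \<le> C * I powr (1 / p)"
      unfolding C_def
      by (rule scaling_exponents[OF _ _ _ I0 _ _ _ _ _ _ A]) (use pq assms(4) s r V C0 c H in auto)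
    have "(r ^ ?n) powr (1 / p) = r powr (real ?n / p)"
      using r by (simp add: powr_powr flip: powr_realpow)
    moreover have "X (r / D) = 1 / s"
      using r pos by (simp add: X_def s_def ln_div inverse_eq_divide)
    moreover have "measure lebesgue (ball z r) = ?V * r ^ ?n"
      using content_ball[of r z] r by simp
    moreover have "(LINT x:ball z r|lebesgue. \<bar>u x\<bar> powr q / norm x powr q) = ?A"
    proof -
      have eq: "indicator (ball z r) x *\<^sub>R (\<bar>u x\<bar> powr q / norm x powr q) = f x powr q" for x
        by (simp add: f_def powr_divide indicator_def)
      have "(\<lambda>x. f x powr q) \<in> borel_measurable lborel"
        using mf by (intro powr_real_measurable) auto
      then show ?thesis unfolding set_lebesgue_integral_def eq by (rule integral_completion)
    qed
    ultimately show ?thesis using fin I0 by (simp add: I_def)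
  qed
  show ?thesis
    by (intro exI[of _ 0] exI[of _ C] conjI allI impI order_refl \<open>0 < C\<close>; use main in \<open>simp\<close>)
qed

end
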